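(* Let $t\ge 2$ be an integer. There is an algorithm that computes all minimal models of a given $t$-CNF theory, and there is an algorithm that computes all answer sets of a given disjunctive $t$-program, each running in time $O(q(m)(3-2/(t+1))^n)$ for some polynomial $q$, where $n$ is the number of atoms and $m$ the size of the input.
   Context: A $t$-CNF theory is a finite set of propositional clauses each with at most $t$ literals (no repeated literal, no complementary pair); a minimal model is a model (set of true atoms) no proper subset of which is a model. A disjunctive $t$-program is a finite set of clauses $a_1\vee\cdots\vee a_p \leftarrow b_1,\ldots,b_r,\mathbf{not}(c_1),\ldots,\mathbf{not}(c_s)$ with $p+r+s\le t$; an answer set of $P$ is a set $M$ of atoms that is a minimal model of the Gelfond–Lifschitz reduct $P^M$. $m$ is the total number of atom occurrences in the input. *)

theory Defs
  imports Complex_Main "HOL-Computational_Algebra.Polynomial"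
begin

section \<open>Propositional theories and disjunctive logic programs\<close>

type_synonym atom = nat

definition minimal_model :: "(atom set \<Rightarrow> bool) \<Rightarrow> atom set \<Rightarrow> bool" where
  "minimal_model is_model M \<longleftrightarrow> is_model M \<and> (\<forall>N. N \<subset> M \<longrightarrow> \<not> is_model N)"

datatype literal = Pos (atom_of: atom) | Neg (atom_of: atom)

type_synonym clause = "literal list"

fun sat_literal :: "atom set \<Rightarrow> literal \<Rightarrow> bool" where
  "sat_literal M (Pos a) \<longleftrightarrow> a \<in> M"
| "sat_literal M (Neg a) \<longleftrightarrow> a \<notin> M"

definition cnf_model :: "clause set \<Rightarrow> atom set \<Rightarrow> bool" where
  "cnf_model T M \<longleftrightarrow> (\<forall>c\<in>T. \<exists>l\<in>set c. sat_literal M l)"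

definition t_cnf :: "nat \<Rightarrow> clause set \<Rightarrow> bool" where
  "t_cnf t T \<longleftrightarrow> finite T \<and>
     (\<forall>c\<in>T. length c \<le> t \<and> distinct c \<and> (\<forall>a. \<not> (Pos a \<in> set c \<and> Neg a \<in> set c)))"

definition cnf_atoms :: "clause set \<Rightarrow> atom set" where
  "cnf_atoms T = (\<Union>c\<in>T. atom_of ` set c)"

definition cnf_size :: "clause set \<Rightarrow> nat" where
  "cnf_size T = (\<Sum>c\<in>T. length c)"

datatype rule = Rule (head: "atom list") (pos_body: "atom list") (neg_body: "atom list")

definition rule_length :: "rule \<Rightarrow> nat" where
  "rule_length r = length (head r) + length (pos_body r) + length (neg_body r)"

definition rule_atoms :: "rule \<Rightarrow> atom set" where
  "rule_atoms r = set (head r) \<union> set (pos_body r) \<union> set (neg_body r)"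

definition sat_rule :: "atom set \<Rightarrow> rule \<Rightarrow> bool" where
  "sat_rule M r \<longleftrightarrow>
     (set (pos_body r) \<subseteq> M \<and> set (neg_body r) \<inter> M = {} \<longrightarrow> set (head r) \<inter> M \<noteq> {})"

definition prog_model :: "rule set \<Rightarrow> atom set \<Rightarrow> bool" where
  "prog_model P M \<longleftrightarrow> (\<forall>r\<in>P. sat_rule M r)"

definition gl_reduct :: "rule set \<Rightarrow> atom set \<Rightarrow> rule set" where
  "gl_reduct P M = {Rule (head r) (pos_body r) [] | r. r \<in> P \<and> set (neg_body r) \<inter> M = {}}"

definition answer_set :: "rule set \<Rightarrow> atom set \<Rightarrow> bool" where
  "answer_set P M \<longleftrightarrow> minimal_model (prog_model (gl_reduct P M)) M"

definition t_program :: "nat \<Rightarrow> rule set \<Rightarrow> bool" where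
  "t_program t P \<longleftrightarrow> finite P \<and> (\<forall>r\<in>P. rule_length r \<le> t)"

definition prog_atoms :: "rule set \<Rightarrow> atom set" where
  "prog_atoms P = (\<Union>r\<in>P. rule_atoms r)"

definition prog_size :: "rule set \<Rightarrow> nat" where
  "prog_size P = (\<Sum>r\<in>P. rule_length r)"


section \<open>Algorithms and their running time\<close>

text \<open>
  Algorithms are programs of a first-order, strict, purely functional language over
  S-expressions (pure LISP) under the usual cost model: evaluating an expression node costs one
  time unit. Every such step takes a constant number of steps on a random access machine, with
  pairs represented by pointers, so time bounds proved here carry over to that model.
  Symbols are opaque: a program can only copy them and test them for equality.
\<close>

datatype sexp = SNil | SSym atom | SPair sexp sexp

text \<open>
  \<open>Arg i\<close> is the \<open>i\<close>-th argument of the function being executed; \<open>Call f es\<close> calls the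
  \<open>f\<close>-th function of the program, which is given by the list of its function bodies.
\<close>

datatype expr =
    Arg nat
  | Null
  | Cons_of expr expr
  | Car expr
  | Cdr expr
  | Eq expr expr
  | Cond expr expr expr
  | Call nat "expr list"

type_synonym lisp = "expr list"

fun car :: "sexp \<Rightarrow> sexp" where
  "car (SPair x y) = x"
| "car _ = SNil"

fun cdr :: "sexp \<Rightarrow> sexp" where
  "cdr (SPair x y) = y"
| "cdr _ = SNil"

text \<open>\<open>SNil\<close> is falsity. Equality of pairs is not primitive, as it would not be a unit-cost
  operation.\<close>

definition sbool :: "bool \<Rightarrow> sexp" where
  "sbool b = (if b then SPair SNil SNil else SNil)"

fun eq_sym :: "sexp \<Rightarrow> sexp \<Rightarrow> bool" where
  "eq_sym (SSym a) (SSym b) \<longleftrightarrow> a = b"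
| "eq_sym SNil SNil \<longleftrightarrow> True"
| "eq_sym _ _ \<longleftrightarrow> False"

text \<open>\<open>eval p env e v k\<close>: with arguments \<open>env\<close>, the expression \<open>e\<close> evaluates to \<open>v\<close> in \<open>k\<close> steps.\<close>

inductive eval :: "lisp \<Rightarrow> sexp list \<Rightarrow> expr \<Rightarrow> sexp \<Rightarrow> nat \<Rightarrow> bool"
  and evals :: "lisp \<Rightarrow> sexp list \<Rightarrow> expr list \<Rightarrow> sexp list \<Rightarrow> nat \<Rightarrow> bool"
  for p :: lisp
where
  eval_Arg: "i < length env \<Longrightarrow> eval p env (Arg i) (env ! i) 1"
| eval_Null: "eval p env Null SNil 1"
| eval_Cons: "eval p env e1 v1 k1 \<Longrightarrow> eval p env e2 v2 k2 \<Longrightarrow>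
    eval p env (Cons_of e1 e2) (SPair v1 v2) (k1 + k2 + 1)"
| eval_Car: "eval p env e v k \<Longrightarrow> eval p env (Car e) (car v) (k + 1)"
| eval_Cdr: "eval p env e v k \<Longrightarrow> eval p env (Cdr e) (cdr v) (k + 1)"
| eval_Eq: "eval p env e1 v1 k1 \<Longrightarrow> eval p env e2 v2 k2 \<Longrightarrow>
    eval p env (Eq e1 e2) (sbool (eq_sym v1 v2)) (k1 + k2 + 1)"
| eval_Cond_true: "eval p env e v k \<Longrightarrow> v \<noteq> SNil \<Longrightarrow> eval p env e1 w k' \<Longrightarrow>
    eval p env (Cond e e1 e2) w (k + k' + 1)"
| eval_Cond_false: "eval p env e SNil k \<Longrightarrow> eval p env e2 w k' \<Longrightarrow>
    eval p env (Cond e e1 e2) w (k + k' + 1)"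
| eval_Call: "f < length p \<Longrightarrow> evals p env es vs k \<Longrightarrow> eval p vs (p ! f) w k' \<Longrightarrow>
    eval p env (Call f es) w (k + k' + 1)"
| evals_Nil: "evals p env [] [] 0"
| evals_Cons: "eval p env e v k \<Longrightarrow> evals p env es vs k' \<Longrightarrow>
    evals p env (e # es) (v # vs) (k + k')"

lemma eval_deterministic:
  "eval p env e v k \<Longrightarrow> eval p env e v' k' \<Longrightarrow> v' = v \<and> k' = k"
  "evals p env es vs k \<Longrightarrow> evals p env es vs' k' \<Longrightarrow> vs' = vs \<and> k' = k"
proof (induction arbitrary: v' k' and vs' k' rule: eval_evals.inducts)
  case (eval_Call f env es vs k w k1)
  from eval_Call.prems show ?case
    by cases (use eval_Call.IH in blast)
next
  case (evals_Cons env e v k es vs k1)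
  from evals_Cons.prems show ?case
    by cases (use evals_Cons.IH in blast)
qed (erule eval.cases evals.cases; blast | erule eval.cases evals.cases; force)+

text \<open>The first function is the main function; it takes the input as its only argument.\<close>

definition runs :: "lisp \<Rightarrow> sexp \<Rightarrow> sexp \<Rightarrow> nat \<Rightarrow> bool" where
  "runs p input output k \<longleftrightarrow> eval p [input] (Call 0 [Arg 0]) output k"


section \<open>Representation of inputs and outputs\<close>

fun enc_list :: "('a \<Rightarrow> sexp) \<Rightarrow> 'a list \<Rightarrow> sexp" where
  "enc_list enc [] = SNil"
| "enc_list enc (x # xs) = SPair (enc x) (enc_list enc xs)"

fun enc_literal :: "literal \<Rightarrow> sexp" where
  "enc_literal (Pos a) = SPair (sbool True) (SSym a)"
| "enc_literal (Neg a) = SPair (sbool False) (SSym a)"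

definition enc_cnf :: "clause list \<Rightarrow> sexp" where
  "enc_cnf = enc_list (enc_list enc_literal)"

fun enc_rule :: "rule \<Rightarrow> sexp" where
  "enc_rule (Rule as bs cs) =
     SPair (enc_list SSym as) (SPair (enc_list SSym bs) (enc_list SSym cs))"

definition enc_prog :: "rule list \<Rightarrow> sexp" where
  "enc_prog = enc_list enc_rule"

definition enc_atom_lists :: "atom list list \<Rightarrow> sexp" where
  "enc_atom_lists = enc_list (enc_list SSym)"

text \<open>\<open>Ms\<close> lists every member of \<open>F\<close> exactly once, each member as a repetition-free list.\<close>

definition enumerates :: "atom list list \<Rightarrow> atom set set \<Rightarrow> bool" where
  "enumerates Ms F \<longleftrightarrow>
     (\<forall>xs\<in>set Ms. distinct xs) \<and> distinct (map set Ms) \<and> set ` set Ms = F"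

end

theory Submission
  imports Defs
begin

text \<open>
  A clause becomes a rule without negated body atoms, and then minimal models are answer sets.
  Answer sets are found by branching on partial assignments \<open>(Tr, Fa)\<close>: if \<open>Tr\<close>
  violates a rule, then an answer set above \<open>Tr\<close> contains one of its at most \<open>t\<close> atoms in
  the head or the negated body; otherwise \<open>Tr\<close> is the only candidate above \<open>Tr\<close>. A candidate
  \<open>M\<close> is tested by searching, for every \<open>a \<in> M\<close>, the subsets of \<open>M - {a}\<close> for a model of the
  reduct. The search runs over the words of a covering code and explores the ball around each
  word by flipping atoms of violated rules, at most \<open>t\<close> choices per unit of radius.

  Let \<open>\<gamma> = 3 - 2/(t+1)\<close>. A test at cost \<open>(\<gamma> - 1)^|M|\<close> for every set \<open>M\<close> would sum to
  \<open>\<gamma>^n\<close>. The branching does not reach all sets: it leaves room for a test at cost \<open>\<beta>^|M|\<close>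
  with \<open>\<beta> = (\<gamma> - 1) / (1 - \<gamma>^(-t))\<close>, because then \<open>\<beta> (1/\<gamma> + \<dots> + 1/\<gamma>^t) = 1\<close>.
  As \<open>\<beta> > \<gamma> - 1 = 2t/(t+1)\<close>, a product of copies of one fixed covering code of constant length is
  good enough, and this code is a constant of the program.
\<close>

section \<open>Evaluation of programs\<close>

text \<open>One program must serve every input, so the bound has to be reached without a covering
  code made for \<open>n\<close> atoms. A block code of constant length \<open>b\<close> loses a
  factor polynomial in \<open>b\<close> per block, and over \<open>n / b\<close> blocks this loss is
  exponential in \<open>n\<close>. The gap between \<open>\<beta>\<close> and
  \<open>2t/(t+1)\<close> pays for it once \<open>b\<close> is large. The number
  \<open>2t/(t+1)\<close> comes from balancing code size against ball search: about
  \<open>2^b / (b choose \<rho>)\<close> words cost \<open>t^\<rho>\<close> each, and by the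
  binomial theorem the product is about \<open>(2t/(t+1))^b\<close> at
  \<open>\<rho> = b/(t+1)\<close>. The gap comes from the branching. The i-th child of a node makes
  one undecided atom true and \<open>i - 1\<close> others false, so it settles \<open>i\<close>
  atoms at once. If a node with \<open>d\<close> undecided atoms has the budget
  \<open>\<beta>^|Tr| * \<gamma>^d\<close>, its i-th child takes the share
  \<open>\<beta> / \<gamma>^i\<close>, and the shares of at most \<open>t\<close> children add up to
  at most 1.\<close>

definition call :: "lisp \<Rightarrow> nat \<Rightarrow> sexp list \<Rightarrow> (sexp \<times> nat) option" where
  "call p f vs =
     (if f < length p \<and> (\<exists>r. eval p vs (p ! f) (fst r) (snd r))
      then Some (SOME r. eval p vs (p ! f) (fst r) (snd r)) else None)"

text \<open>The relation \<open>eval\<close> is awkward to execute by rewriting. \<open>ev\<close>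
  is structural in the expression and stops at the opaque \<open>call\<close>, so it is total
  although the programs are recursive.\<close>

fun ev :: "lisp \<Rightarrow> sexp list \<Rightarrow> expr \<Rightarrow> (sexp \<times> nat) option"
  and evl :: "lisp \<Rightarrow> sexp list \<Rightarrow> expr list \<Rightarrow> (sexp list \<times> nat) option" where
  "ev p env (Arg i) = (if i < length env then Some (env ! i, 1) else None)"
| "ev p env Null = Some (SNil, 1)"
| "ev p env (Cons_of e1 e2) =
     (case ev p env e1 of None \<Rightarrow> None | Some (v1, k1) \<Rightarrow>
      (case ev p env e2 of None \<Rightarrow> None | Some (v2, k2) \<Rightarrow> Some (SPair v1 v2, k1 + k2 + 1)))"
| "ev p env (Car e) = (case ev p env e of None \<Rightarrow> None | Some (v, k) \<Rightarrow> Some (car v, k + 1))"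
| "ev p env (Cdr e) = (case ev p env e of None \<Rightarrow> None | Some (v, k) \<Rightarrow> Some (cdr v, k + 1))"
| "ev p env (Eq e1 e2) =
     (case ev p env e1 of None \<Rightarrow> None | Some (v1, k1) \<Rightarrow>
      (case ev p env e2 of None \<Rightarrow> None | Some (v2, k2) \<Rightarrow>
         Some (sbool (eq_sym v1 v2), k1 + k2 + 1)))"
| "ev p env (Cond e e1 e2) =
     (case ev p env e of None \<Rightarrow> None | Some (v, k) \<Rightarrow>
      (case (if v \<noteq> SNil then ev p env e1 else ev p env e2) of None \<Rightarrow> None | Some (w, k') \<Rightarrow>
         Some (w, k + k' + 1)))"
| "ev p env (Call f es) =
     (case evl p env es of None \<Rightarrow> None | Some (vs, k) \<Rightarrow>
      (case call p f vs of None \<Rightarrow> None | Some (w, k') \<Rightarrow> Some (w, k + k' + 1)))"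
| "evl p env [] = Some ([], 0)"
| "evl p env (e # es) =
     (case ev p env e of None \<Rightarrow> None | Some (v, k) \<Rightarrow>
      (case evl p env es of None \<Rightarrow> None | Some (vs, k') \<Rightarrow> Some (v # vs, k + k')))"

lemma call_eq_Some_iff:
  "call p f vs = Some (w, k) \<longleftrightarrow> f < length p \<and> eval p vs (p ! f) w k"
proof
  assume a: "call p f vs = Some (w, k)"
  then have "\<exists>r. eval p vs (p ! f) (fst r) (snd r)" and f: "f < length p"
    and w: "(w, k) = (SOME r. eval p vs (p ! f) (fst r) (snd r))"
    by (auto simp: call_def split: if_splits)
  from someI_ex[OF this(1)] w[symmetric] f show "f < length p \<and> eval p vs (p ! f) w k" by simp
next
  assume a: "f < length p \<and> eval p vs (p ! f) w k"
  have "(SOME r. eval p vs (p ! f) (fst r) (snd r)) = (w, k)"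
  proof (rule some_equality)
    show "eval p vs (p ! f) (fst (w, k)) (snd (w, k))" using a by simp
    fix r assume "eval p vs (p ! f) (fst r) (snd r)"
    then show "r = (w, k)" using a eval_deterministic(1) by (metis prod.collapse)
  qed
  moreover have "\<exists>r. eval p vs (p ! f) (fst r) (snd r)" using a by (intro exI[of _ "(w, k)"]) simp
  ultimately show "call p f vs = Some (w, k)" using a by (simp add: call_def)
qed

lemma ev_imp_eval:
  "ev p env e = Some (w, k) \<Longrightarrow> eval p env e w k"
  "evl p env es = Some (ws, k) \<Longrightarrow> evals p env es ws k"
proof (induction p env e and p env es arbitrary: w k and ws k rule: ev_evl.induct)
  case (1 p env i)
  then show ?case using eval_Arg[of i env p] by (auto split: if_splits)
next
  case (8 p env f es)
  then show ?case
    by (auto split: option.splits prod.splits simp: call_eq_Some_iff intro!: eval_Call[simplified])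
qed (auto split: option.splits prod.splits if_splits intro: eval_evals.intros[simplified])

lemma eval_imp_ev:
  "eval p env e w k \<Longrightarrow> ev p env e = Some (w, k)"
  "evals p env es ws k \<Longrightarrow> evl p env es = Some (ws, k)"
proof (induction rule: eval_evals.inducts)
  case (eval_Call f env es vs k w k')
  then have "call p f vs = Some (w, k')" by (simp add: call_eq_Some_iff)
  then show ?case using eval_Call by simp
qed auto

text \<open>One \<open>subst\<close> with this equation executes a single function body; as a simp
  rule it could unfold recursive calls without end.\<close>

lemma call_unfold:
  assumes "f < length p"
  shows "call p f vs = ev p vs (p ! f)"
proof (cases "ev p vs (p ! f)")
  case None
  have "call p f vs \<noteq> Some r" for r
    using None eval_imp_ev(1) by (cases r) (auto simp: call_eq_Some_iff)
  then show ?thesis using None by (cases "call p f vs") auto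
next
  case (Some r)
  then show ?thesis using assms ev_imp_eval(1) by (cases r) (auto simp: call_eq_Some_iff)
qed

lemma runs_if_call:
  assumes "call p 0 [input] = Some (v, k)"
  shows "runs p input v (k + 2)"
proof -
  have "ev p [input] (Call 0 [Arg 0]) = Some (v, k + 2)" using assms by simp
  then show ?thesis unfolding runs_def by (rule ev_imp_eval)
qed

section \<open>Encodings, quoted constants and toggling\<close>

abbreviation "syms \<equiv> enc_list SSym"

lemma sbool_eq_SNil_iff [simp]: "sbool b = SNil \<longleftrightarrow> \<not> b"
  by (simp add: sbool_def)

text \<open>The language has no numbers: a radius is tested for zero by \<open>Cond\<close> and
  decremented by \<open>Cdr\<close>.\<close>

fun unary :: "nat \<Rightarrow> sexp" where
  "unary 0 = SNil"
| "unary (Suc n) = SPair SNil (unary n)"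

text \<open>The only literal is \<open>Null\<close>, so a constant list must be built by an
  expression. Codewords consist of truth values because a program cannot mention symbols.\<close>

fun quote_list :: "('a \<Rightarrow> expr) \<Rightarrow> 'a list \<Rightarrow> expr" where
  "quote_list q [] = Null"
| "quote_list q (x # xs) = Cons_of (q x) (quote_list q xs)"

abbreviation "true_expr \<equiv> Cons_of Null Null"

abbreviation quote_bool :: "bool \<Rightarrow> expr" where
  "quote_bool b \<equiv> (if b then true_expr else Null)"

lemma ev_quote_list:
  assumes "\<And>x. x \<in> set xs \<Longrightarrow> \<exists>k. \<forall>p env. ev p env (q x) = Some (enc x, k)"
  shows "\<exists>k. \<forall>p env. ev p env (quote_list q xs) = Some (enc_list enc xs, k)"
  using assms
proof (induction xs)
  case (Cons x xs)
  then obtain k k' where "\<forall>p env. ev p env (q x) = Some (enc x, k)"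
    "\<forall>p env. ev p env (quote_list q xs) = Some (enc_list enc xs, k')" by auto metis
  then show ?case by auto
qed auto

text \<open>The cost is uniform in \<open>p\<close> and \<open>env\<close>, so it can enter the
  polynomial before the main expression and the input are fixed.\<close>

lemma ev_quote_code:
  "\<exists>k. \<forall>p env. ev p env (quote_list (quote_list quote_bool) cs) =
     Some (enc_list (enc_list sbool) cs, k)"
proof -
  have "\<exists>k. \<forall>p env. ev p env (quote_bool b) = Some (sbool b, k)" for b
    by (auto simp: sbool_def)
  then show ?thesis by (intro ev_quote_list)
qed

lemma ev_add_unary:
  "ev p env e = Some (unary m, k) \<Longrightarrow>
     ev p env ((Cons_of Null ^^ n) e) = Some (unary (n + m), 2 * n + k)"
  by (induction n) auto

fun toggle :: "'a \<Rightarrow> 'a list \<Rightarrow> 'a list" where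
  "toggle a [] = [a]"
| "toggle a (b # xs) = (if a = b then xs else b # toggle a xs)"

lemma set_toggle: "distinct xs \<Longrightarrow> set (toggle a xs) = sym_diff {a} (set xs)"
  by (induction xs) auto

lemma distinct_toggle: "distinct xs \<Longrightarrow> distinct (toggle a xs)"
  by (induction xs) (auto simp: set_toggle)

text \<open>Two sets, because the reduct is never built: \<open>X\<close> is tested against the
  rules that survive for \<open>M\<close>. With \<open>X = M\<close> this is violation of the rule
  itself.\<close>

definition violates :: "rule \<Rightarrow> atom set \<Rightarrow> atom set \<Rightarrow> bool" where
  "violates r X M \<longleftrightarrow>
     set (pos_body r) \<subseteq> X \<and> set (head r) \<inter> X = {} \<and> set (neg_body r) \<inter> M = {}"

section \<open>The program\<close>

abbreviation (input) "MEM \<equiv> 1::nat"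
abbreviation (input) "SUBSET \<equiv> 2::nat"
abbreviation (input) "DISJOINT \<equiv> 3::nat"
abbreviation (input) "APPEND \<equiv> 4::nat"
abbreviation (input) "TOGGLE \<equiv> 5::nat"
abbreviation (input) "VIOLATED \<equiv> 6::nat"
abbreviation (input) "SEARCH \<equiv> 7::nat"
abbreviation (input) "SEARCH_AT \<equiv> 8::nat"
abbreviation (input) "SEARCH_FLIPS \<equiv> 9::nat"
abbreviation (input) "CENTRES \<equiv> 10::nat"
abbreviation (input) "CODEWORDS \<equiv> 11::nat"
abbreviation (input) "BLOCK \<equiv> 12::nat"
abbreviation (input) "MINIMAL \<equiv> 13::nat"
abbreviation (input) "ENUM \<equiv> 14::nat"
abbreviation (input) "ENUM_AT \<equiv> 15::nat"
abbreviation (input) "ENUM_BRANCH \<equiv> 16::nat"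
abbreviation (input) "CLAUSE \<equiv> 17::nat"
abbreviation (input) "CLAUSES \<equiv> 18::nat"

section \<open>Function bodies\<close>

definition "mem_body = Cond (Arg 1)
  (Cond (Eq (Arg 0) (Car (Arg 1))) true_expr (Call MEM [Arg 0, Cdr (Arg 1)])) Null"

definition "subset_body = Cond (Arg 0)
  (Cond (Call MEM [Car (Arg 0), Arg 1]) (Call SUBSET [Cdr (Arg 0), Arg 1]) Null) true_expr"

definition "disjoint_body = Cond (Arg 0)
  (Cond (Call MEM [Car (Arg 0), Arg 1]) Null (Call DISJOINT [Cdr (Arg 0), Arg 1])) true_expr"

definition "append_body = Cond (Arg 0)
  (Cons_of (Car (Arg 0)) (Call APPEND [Cdr (Arg 0), Arg 1])) (Arg 1)"

definition "toggle_body = Cond (Arg 1)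
  (Cond (Eq (Arg 0) (Car (Arg 1))) (Cdr (Arg 1))
     (Cons_of (Car (Arg 1)) (Call TOGGLE [Arg 0, Cdr (Arg 1)])))
  (Cons_of (Arg 0) Null)"

text \<open>The nested \<open>Cond\<close> terms form a conjunction. The result is the rule itself,
  whose atoms the callers need; its code is a pair and hence counts as true.\<close>

definition "violated_body = Cond (Arg 0)
  (Cond
    (Cond (Call SUBSET [Car (Cdr (Car (Arg 0))), Arg 1])
      (Cond (Call DISJOINT [Car (Car (Arg 0)), Arg 1])
        (Call DISJOINT [Cdr (Cdr (Car (Arg 0))), Arg 2]) Null) Null)
    (Car (Arg 0))
    (Call VIOLATED [Cdr (Arg 0), Arg 1, Arg 2]))
  Null"

text \<open>The arguments of \<open>SEARCH\<close> are the rules, the atoms that may be flipped, the set \<open>M\<close> that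
  defines the reduct, the current word, and the radius in unary.\<close>

definition "search_body =
  Call SEARCH_AT [Call VIOLATED [Arg 0, Arg 3, Arg 2], Arg 0, Arg 1, Arg 2, Arg 3, Arg 4]"

text \<open>There is no let: passing the result of \<open>VIOLATED\<close> as an argument avoids
  evaluating it twice. \<open>ENUM_AT\<close> is split from \<open>ENUM\<close> for the same
  reason.\<close>

definition "search_at_body = Cond (Arg 0)
  (Cond (Arg 5)
    (Call SEARCH_FLIPS [Call APPEND [Car (Arg 0), Car (Cdr (Arg 0))],
               Arg 1, Arg 2, Arg 3, Arg 4, Cdr (Arg 5)])
    Null)
  true_expr"

text \<open>The word and the sought model both lie within the flippable atoms, so they never differ
  on an atom that is skipped here.\<close>

definition "search_flips_body = Cond (Arg 0)
  (Cond
    (Cond (Call MEM [Car (Arg 0), Arg 2])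
      (Call SEARCH [Arg 1, Arg 2, Arg 3, Call TOGGLE [Car (Arg 0), Arg 4], Arg 5]) Null)
    true_expr
    (Call SEARCH_FLIPS [Cdr (Arg 0), Arg 1, Arg 2, Arg 3, Arg 4, Arg 5]))
  Null"

text \<open>\<open>CENTRES\<close> receives the atoms on which the centre is still undecided, the centre so far and the
  radius so far, followed by the rules, the atoms that may be flipped and \<open>M\<close>. Each codeword
  decides the next block of atoms; it is cut off if fewer atoms are left.\<close>

definition "centres_body code rho = Cond (Arg 0)
  (Call CODEWORDS [quote_list (quote_list quote_bool) code, Arg 0, Arg 1,
              (Cons_of Null ^^ rho) (Arg 2), Arg 3, Arg 4, Arg 5])
  (Call SEARCH [Arg 3, Arg 4, Arg 5, Arg 1, Arg 2])"

definition "codewords_body = Cond (Arg 0)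
  (Cond (Call BLOCK [Car (Arg 0), Arg 1, Arg 2, Arg 3, Arg 4, Arg 5, Arg 6])
    true_expr
    (Call CODEWORDS [Cdr (Arg 0), Arg 1, Arg 2, Arg 3, Arg 4, Arg 5, Arg 6]))
  Null"

definition "block_body = Cond (Cond (Arg 0) (Arg 1) Null)
  (Call BLOCK [Cdr (Arg 0), Cdr (Arg 1),
             Cond (Car (Arg 0)) (Cons_of (Car (Arg 1)) (Arg 2)) (Arg 2),
             Arg 3, Arg 4, Arg 5, Arg 6])
  (Call CENTRES [Arg 1, Arg 2, Arg 3, Arg 4, Arg 5, Arg 6])"

text \<open>Toggling an atom of a repetition-free list removes it.\<close>

definition "minimal_body = Cond (Arg 0)
  (Cond (Call CENTRES [Call TOGGLE [Car (Arg 0), Arg 1], Null, Null, Arg 2,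
                   Call TOGGLE [Car (Arg 0), Arg 1], Arg 1])
    Null
    (Call MINIMAL [Cdr (Arg 0), Arg 1, Arg 2]))
  true_expr"

text \<open>The arguments of \<open>ENUM\<close> are the rules, the atoms made true, the atoms made false, and an
  accumulator for the output.\<close>

definition "enum_body =
  Call ENUM_AT [Call VIOLATED [Arg 0, Arg 1, Arg 1], Arg 0, Arg 1, Arg 2, Arg 3]"

definition "enum_at_body = Cond (Arg 0)
  (Call ENUM_BRANCH [Call APPEND [Car (Arg 0), Cdr (Cdr (Arg 0))], Arg 1, Arg 2, Arg 3, Arg 4])
  (Cond (Call MINIMAL [Arg 2, Arg 2, Arg 1]) (Cons_of (Arg 2) (Arg 4)) (Arg 4))"

text \<open>Making the earlier atoms false keeps the branches disjoint, so no answer set is listed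
  twice. The inner call collects the later branches and becomes the accumulator of the first one, so
  outputs are never concatenated. The test for false atoms also skips repeated atoms of the
  rule.\<close>

definition "enum_branch_body = Cond (Arg 0)
  (Cond (Call MEM [Car (Arg 0), Arg 3])
    (Call ENUM_BRANCH [Cdr (Arg 0), Arg 1, Arg 2, Arg 3, Arg 4])
    (Call ENUM [Arg 1, Cons_of (Car (Arg 0)) (Arg 2), Arg 3,
      Call ENUM_BRANCH [Cdr (Arg 0), Arg 1, Arg 2, Cons_of (Car (Arg 0)) (Arg 3), Arg 4]]))
  (Arg 4)"

definition "clause_body = Cond (Arg 0)
  (Cond (Car (Car (Arg 0)))
    (Call CLAUSE [Cdr (Arg 0), Cons_of (Cdr (Car (Arg 0))) (Arg 1), Arg 2])
    (Call CLAUSE [Cdr (Arg 0), Arg 1, Cons_of (Cdr (Car (Arg 0))) (Arg 2)]))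
  (Cons_of (Arg 1) (Cons_of (Arg 2) Null))"

definition "clauses_body = Cond (Arg 0)
  (Cons_of (Call CLAUSE [Car (Arg 0), Null, Null]) (Call CLAUSES [Cdr (Arg 0)])) Null"

text \<open>The algorithms for theories and for programs differ only in \<open>main\<close>.\<close>

locale answer_set_program =
  fixes main :: expr and code :: "bool list list" and rho :: nat
begin

definition prog :: lisp where
  "prog = [main, mem_body, subset_body, disjoint_body, append_body, toggle_body, violated_body,
     search_body, search_at_body, search_flips_body, centres_body code rho, codewords_body,
     block_body, minimal_body, enum_body, enum_at_body, enum_branch_body, clause_body, clauses_body]"

lemma call_prog:
  "call prog 0 vs = ev prog vs main"
  "call prog MEM vs = ev prog vs mem_body"
  "call prog SUBSET vs = ev prog vs subset_body"
  "call prog DISJOINT vs = ev prog vs disjoint_body"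
  "call prog APPEND vs = ev prog vs append_body"
  "call prog TOGGLE vs = ev prog vs toggle_body"
  "call prog VIOLATED vs = ev prog vs violated_body"
  "call prog SEARCH vs = ev prog vs search_body"
  "call prog SEARCH_AT vs = ev prog vs search_at_body"
  "call prog SEARCH_FLIPS vs = ev prog vs search_flips_body"
  "call prog CENTRES vs = ev prog vs (centres_body code rho)"
  "call prog CODEWORDS vs = ev prog vs codewords_body"
  "call prog BLOCK vs = ev prog vs block_body"
  "call prog MINIMAL vs = ev prog vs minimal_body"
  "call prog ENUM vs = ev prog vs enum_body"
  "call prog ENUM_AT vs = ev prog vs enum_at_body"
  "call prog ENUM_BRANCH vs = ev prog vs enum_branch_body"
  "call prog CLAUSE vs = ev prog vs clause_body"
  "call prog CLAUSES vs = ev prog vs clauses_body"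
  by (simp_all add: call_unfold prog_def)

section \<open>Correctness and cost of the list functions\<close>

lemma call_mem:
  "\<exists>k. call prog MEM [SSym a, syms xs] = Some (sbool (a \<in> set xs), k) \<and> k \<le> 20 * (length xs + 1)"
proof (induction xs)
  case Nil
  show ?case by (subst call_prog) (simp add: mem_body_def sbool_def)
next
  case (Cons b xs)
  then obtain k where "call prog MEM [SSym a, syms xs] = Some (sbool (a \<in> set xs), k)"
    "k \<le> 20 * (length xs + 1)" by blast
  then show ?case by (subst call_prog) (simp add: mem_body_def sbool_def)
qed

lemma call_subset:
  "\<exists>k. call prog SUBSET [syms xs, syms ys] = Some (sbool (set xs \<subseteq> set ys), k) \<and>
     k \<le> 40 * (length xs + 1) * (length ys + 1)"
proof (induction xs)
  case Nil
  show ?case by (subst call_prog) (simp add: subset_body_def sbool_def)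
next
  case (Cons b xs)
  then obtain k where "call prog SUBSET [syms xs, syms ys] = Some (sbool (set xs \<subseteq> set ys), k)"
    "k \<le> 40 * (length xs + 1) * (length ys + 1)" by blast
  moreover obtain k' where "call prog MEM [SSym b, syms ys] = Some (sbool (b \<in> set ys), k')"
    "k' \<le> 20 * (length ys + 1)" using call_mem by blast
  ultimately show ?case by (subst call_prog) (simp add: subset_body_def sbool_def algebra_simps)
qed

lemma call_disjoint:
  "\<exists>k. call prog DISJOINT [syms xs, syms ys] = Some (sbool (set xs \<inter> set ys = {}), k) \<and>
     k \<le> 40 * (length xs + 1) * (length ys + 1)"
proof (induction xs)
  case Nil
  show ?case by (subst call_prog) (simp add: disjoint_body_def sbool_def)
next
  case (Cons b xs)
  then obtain k where "call prog DISJOINT [syms xs, syms ys] = Some (sbool (set xs \<inter> set ys = {}), k)"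
    "k \<le> 40 * (length xs + 1) * (length ys + 1)" by blast
  moreover obtain k' where "call prog MEM [SSym b, syms ys] = Some (sbool (b \<in> set ys), k')"
    "k' \<le> 20 * (length ys + 1)" using call_mem by blast
  ultimately show ?case by (subst call_prog) (simp add: disjoint_body_def sbool_def algebra_simps)
qed

lemma call_append:
  "\<exists>k. call prog APPEND [syms xs, syms ys] = Some (syms (xs @ ys), k) \<and> k \<le> 20 * (length xs + 1)"
proof (induction xs)
  case Nil
  show ?case by (subst call_prog) (simp add: append_body_def)
next
  case (Cons b xs)
  then obtain k where "call prog APPEND [syms xs, syms ys] = Some (syms (xs @ ys), k)"
    "k \<le> 20 * (length xs + 1)" by blast
  then show ?case by (subst call_prog) (simp add: append_body_def)
qed

lemma call_toggle:
  "\<exists>k. call prog TOGGLE [SSym a, syms xs] = Some (syms (toggle a xs), k) \<and> k \<le> 20 * (length xs + 1)"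
proof (induction xs)
  case Nil
  show ?case by (subst call_prog) (simp add: toggle_body_def)
next
  case (Cons b xs)
  then obtain k where "call prog TOGGLE [SSym a, syms xs] = Some (syms (toggle a xs), k)"
    "k \<le> 20 * (length xs + 1)" by blast
  then show ?case by (subst call_prog) (simp add: toggle_body_def)
qed

lemma call_violated:
  assumes "\<forall>r\<in>set rs. rule_length r \<le> s" "length X \<le> s" "length M \<le> s"
  shows "\<exists>k. call prog VIOLATED [enc_prog rs, syms X, syms M] =
      Some (case find (\<lambda>r. violates r (set X) (set M)) rs of None \<Rightarrow> SNil | Some r \<Rightarrow> enc_rule r, k) \<and>
    k \<le> 160 * (length rs + 1) * (s + 1)^2"
  using assms(1)
proof (induction rs)
  case Nil
  have "3 * 1 \<le> 160 * (s + 1)^2" by (intro mult_mono) auto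
  then show ?case
    by (subst call_prog) (simp add: violated_body_def enc_prog_def)
next
  case (Cons r rs)
  then obtain k where k: "call prog VIOLATED [enc_prog rs, syms X, syms M] =
      Some (case find (\<lambda>r. violates r (set X) (set M)) rs of None \<Rightarrow> SNil | Some r \<Rightarrow> enc_rule r, k)"
    "k \<le> 160 * (length rs + 1) * (s + 1)^2" by auto
  obtain hs ps ns where r: "r = Rule hs ps ns" by (cases r)
  have len: "length hs \<le> s" "length ps \<le> s" "length ns \<le> s"
    using Cons.prems by (auto simp: r rule_length_def)
  obtain k1 where k1: "call prog SUBSET [syms ps, syms X] = Some (sbool (set ps \<subseteq> set X), k1)"
    "k1 \<le> 40 * (length ps + 1) * (length X + 1)" using call_subset by blast
  obtain k2 where k2: "call prog DISJOINT [syms hs, syms X] = Some (sbool (set hs \<inter> set X = {}), k2)"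
    "k2 \<le> 40 * (length hs + 1) * (length X + 1)" using call_disjoint by blast
  obtain k3 where k3: "call prog DISJOINT [syms ns, syms M] = Some (sbool (set ns \<inter> set M = {}), k3)"
    "k3 \<le> 40 * (length ns + 1) * (length M + 1)" using call_disjoint by blast
  have b: "40 * (length xs + 1) * (length ys + 1) \<le> 40 * (s + 1)^2"
    if "length xs \<le> s" "length ys \<le> s" for xs ys :: "nat list"
    unfolding power2_eq_square mult.assoc using that by (intro mult_mono) auto
  have "k1 \<le> 40 * (s + 1)^2" "k2 \<le> 40 * (s + 1)^2" "k3 \<le> 40 * (s + 1)^2"
    using k1(2) k2(2) k3(2) b len assms(2,3) by (meson le_trans)+
  moreover have "(1::nat) \<le> (s + 1)^2" by simp
  \<comment> \<open>Three list comparisons cost \<open>40 * (s + 1)^2\<close> each; the fourth share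
    of 40 covers the overhead.\<close>
  ultimately have "k + k1 + k2 + k3 + 40 \<le> 160 * (length rs + 1) * (s + 1)^2 + 160 * (s + 1)^2"
    using k(2) by linarith
  also have "\<dots> = 160 * (length (r # rs) + 1) * (s + 1)^2" by (simp add: algebra_simps)
  finally have "k + k1 + k2 + k3 + 40 \<le> 160 * (length (r # rs) + 1) * (s + 1)^2" .
  moreover have "\<exists>k'. call prog VIOLATED [enc_prog (r # rs), syms X, syms M] =
      Some (case find (\<lambda>r. violates r (set X) (set M)) (r # rs) of
        None \<Rightarrow> SNil | Some r \<Rightarrow> enc_rule r, k') \<and> k' \<le> k + k1 + k2 + k3 + 40"
    using k(1) k1(1) k2(1) k3(1)
    by (subst call_prog) (simp add: violated_body_def enc_prog_def r violates_def)
  ultimately show ?case by (meson le_trans)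
qed

end

section \<open>Local search\<close>

text \<open>Semantically, \<open>N\<close> is a model of the reduct by \<open>M\<close>; the proof
  of \<open>answer_set_iff\<close> makes the link.\<close>

definition unviolated :: "rule list \<Rightarrow> atom set \<Rightarrow> atom set \<Rightarrow> bool" where
  "unviolated rs M N \<longleftrightarrow> (\<forall>r\<in>set rs. \<not> violates r N M)"

text \<open>\<open>t\<close> is the base of the exponentials, \<open>s\<close> the parameter of the
  polynomials; the theorem takes the input size plus one for \<open>s\<close>.\<close>

locale bounded_input = answer_set_program +
  fixes rs :: "rule list" and t s :: nat
  assumes length_rules: "length rs \<le> s"
    and rule_length_le_t: "r \<in> set rs \<Longrightarrow> rule_length r \<le> t"
    and rule_length_le_s: "r \<in> set rs \<Longrightarrow> rule_length r \<le> s"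
    and t_pos: "0 < t"
begin

section \<open>Cost units and the ball search\<close>

definition z :: real where
  "z = real s + 1"

text \<open>A \<open>VIOLATED\<close> call costs at most \<open>160 * z^3\<close>; the rest is room
  for the linear list operations at a search node.\<close>

definition step_cost :: real where
  "step_cost = 400 * z^3"

lemma z_bounds: "1 \<le> z" "z \<le> z^2" "z^2 \<le> z^3" "z \<le> z^3" "1 \<le> z^3"
proof -
  show z: "1 \<le> z" by (simp add: z_def)
  show "z \<le> z^2" "z^2 \<le> z^3" "z \<le> z^3" "1 \<le> z^3"
    using z power_increasing[OF _ z, of 1 2] power_increasing[OF _ z, of 2 3]
      power_increasing[OF _ z, of 1 3] power_increasing[OF _ z, of 0 3] by auto
qed

lemma linear_cost:
  assumes "k \<le> 20 * (l + 1)" "l \<le> s"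
  shows "real k \<le> 20 * z"
proof -
  have "k \<le> 20 * (s + 1)" using assms by simp
  then have "real k \<le> real (20 * (s + 1))" by (simp only: of_nat_le_iff)
  then show ?thesis by (simp add: z_def algebra_simps)
qed

lemma call_violated_cube:
  assumes "length X \<le> s" "length M \<le> s"
  shows "\<exists>k. call prog VIOLATED [enc_prog rs, syms X, syms M] =
      Some (case find (\<lambda>r. violates r (set X) (set M)) rs of None \<Rightarrow> SNil | Some r \<Rightarrow> enc_rule r, k) \<and>
    real k \<le> 160 * z^3"
proof -
  obtain k where k: "call prog VIOLATED [enc_prog rs, syms X, syms M] =
      Some (case find (\<lambda>r. violates r (set X) (set M)) rs of None \<Rightarrow> SNil | Some r \<Rightarrow> enc_rule r, k)"
    "k \<le> 160 * (length rs + 1) * (s + 1)^2"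
    using call_violated[OF _ assms] rule_length_le_s by blast
  have "160 * (length rs + 1) * (s + 1)^2 \<le> 160 * (s + 1) * (s + 1)^2"
    using length_rules by (intro mult_le_mono) auto
  also have "\<dots> = 160 * (s + 1)^3" by (simp only: power3_eq_cube power2_eq_square mult.assoc)
  finally have "k \<le> 160 * (s + 1)^3" using k(2) by linarith
  then have "real k \<le> real (160 * (s + 1)^3)" by (simp only: of_nat_le_iff)
  then show ?thesis using k(1) by (auto simp: z_def add.commute)
qed

text \<open>The answer is specified one-sidedly: success only certifies (\<open>Q\<close>) that some
  model exists, wherever it lies, and failure only excludes models close to a flipped word
  (\<open>W\<close>). \<open>SEARCH\<close> enters as a hypothesis, which separates the induction on
  the list from that on the radius.\<close>

lemma call_search_flips:
  assumes "length A \<le> s" "length x \<le> s"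
    and "\<And>a. a \<in> set A \<Longrightarrow> \<exists>v k. call prog SEARCH [R, syms A, M, syms (toggle a x), r] = Some (v, k) \<and>
      real k \<le> B \<and> (v \<noteq> SNil \<longrightarrow> Q) \<and> (W a \<longrightarrow> v \<noteq> SNil)"
    and "0 \<le> B"
  shows "\<exists>v k. call prog SEARCH_FLIPS [syms as, R, syms A, M, syms x, r] = Some (v, k) \<and>
      real k \<le> length as * (B + 80 * z) + 3 \<and> (v \<noteq> SNil \<longrightarrow> Q) \<and>
      ((\<exists>a\<in>set as. a \<in> set A \<and> W a) \<longrightarrow> v \<noteq> SNil)"
proof (induction as)
  case Nil
  show ?case by (subst call_prog) (simp add: search_flips_body_def)
next
  case (Cons a as)
  then obtain v k where k: "call prog SEARCH_FLIPS [syms as, R, syms A, M, syms x, r] = Some (v, k)"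
    "real k \<le> length as * (B + 80 * z) + 3" "v \<noteq> SNil \<longrightarrow> Q"
    "(\<exists>a\<in>set as. a \<in> set A \<and> W a) \<longrightarrow> v \<noteq> SNil" by blast
  obtain k1 where k1: "call prog MEM [SSym a, syms A] = Some (sbool (a \<in> set A), k1)"
    "k1 \<le> 20 * (length A + 1)" using call_mem by blast
  obtain k2 where k2: "call prog TOGGLE [SSym a, syms x] = Some (syms (toggle a x), k2)"
    "k2 \<le> 20 * (length x + 1)" using call_toggle by blast
  have b: "real k1 \<le> 20 * z" "real k2 \<le> 20 * z"
    using linear_cost assms(1,2) k1(2) k2(2) by blast+
  show ?case
  proof (cases "a \<in> set A")
    case True
    obtain v' k' where k': "call prog SEARCH [R, syms A, M, syms (toggle a x), r] = Some (v', k')"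
      "real k' \<le> B" "v' \<noteq> SNil \<longrightarrow> Q" "W a \<longrightarrow> v' \<noteq> SNil" using assms(3)[OF True] by blast
    have "real k + k1 + k2 + k' + 40 \<le> length (a # as) * (B + 80 * z) + 3"
      using k(2) b k'(2) z_bounds(1) by (simp add: algebra_simps)
    moreover have "\<exists>w k''. call prog SEARCH_FLIPS [syms (a # as), R, syms A, M, syms x, r] = Some (w, k'') \<and>
      real k'' \<le> real k + k1 + k2 + k' + 40 \<and> (w = SNil \<longleftrightarrow> v' = SNil \<and> v = SNil)"
      using k(1) k1(1) k2(1) k'(1) True by (subst call_prog) (simp add: search_flips_body_def)
    then obtain w k'' where "call prog SEARCH_FLIPS [syms (a # as), R, syms A, M, syms x, r] = Some (w, k'')"
      "real k'' \<le> real k + k1 + k2 + k' + 40" "w = SNil \<longleftrightarrow> v' = SNil \<and> v = SNil"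
      by blast
    ultimately show ?thesis using k k' by (intro exI[of _ w] exI[of _ k'']) auto
  next
    case False
    have "real k + k1 + 40 \<le> length (a # as) * (B + 80 * z) + 3"
      using k(2) b assms(4) z_bounds(1) by (simp add: algebra_simps)
    moreover have "\<exists>k''. call prog SEARCH_FLIPS [syms (a # as), R, syms A, M, syms x, r] = Some (v, k'') \<and>
      real k'' \<le> real k + k1 + 40"
      using k(1) k1(1) False by (subst call_prog) (simp add: search_flips_body_def)
    then obtain k'' where "call prog SEARCH_FLIPS [syms (a # as), R, syms A, M, syms x, r] = Some (v, k'')"
      "real k'' \<le> real k + k1 + 40" by blast
    ultimately show ?thesis using k False by (intro exI[of _ v] exI[of _ k'']) auto
  qed
qed

text \<open>Only atoms of one violated rule are tried, so the exploration costs \<open>t ^ r\<close>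
  up to a polynomial factor, whatever the number of flippable atoms.\<close>

lemma call_search:
  assumes "distinct A" "length A \<le> s" "length M \<le> s"
  shows "\<lbrakk>distinct x; set x \<subseteq> set A\<rbrakk> \<Longrightarrow>
    \<exists>v k. call prog SEARCH [enc_prog rs, syms A, syms M, syms x, unary r] = Some (v, k) \<and>
      real k \<le> 3 * step_cost * (real r + 1) * real t ^ r \<and>
      (v \<noteq> SNil \<longrightarrow> (\<exists>N\<subseteq>set A. unviolated rs (set M) N)) \<and>
      ((\<exists>N\<subseteq>set A. unviolated rs (set M) N \<and> card (sym_diff (set x) N) \<le> r) \<longrightarrow> v \<noteq> SNil)"
proof (induction r arbitrary: x)
  case (0 x)
  have lx: "length x \<le> s"
    using 0 assms(1,2) by (metis card_mono distinct_card finite_set le_trans)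
  obtain k where k: "call prog VIOLATED [enc_prog rs, syms x, syms M] =
      Some (case find (\<lambda>r. violates r (set x) (set M)) rs of None \<Rightarrow> SNil | Some r \<Rightarrow> enc_rule r, k)"
    "real k \<le> 160 * z^3" using call_violated_cube[OF lx assms(3)] by blast
  have b: "real k + 40 \<le> 3 * step_cost" using k(2) z_bounds(5) unfolding step_cost_def by linarith
  show ?case
  proof (cases "find (\<lambda>r. violates r (set x) (set M)) rs")
    case None
    then have "unviolated rs (set M) (set x)" by (auto simp: find_None_iff unviolated_def)
    moreover have "\<exists>k'. call prog SEARCH [enc_prog rs, syms A, syms M, syms x, unary 0] =
        Some (SPair SNil SNil, k') \<and> k' \<le> k + 40"
      using k(1) None by (subst call_prog) (simp add: search_body_def call_prog(9) search_at_body_def)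
    then obtain k' where "call prog SEARCH [enc_prog rs, syms A, syms M, syms x, unary 0] =
        Some (SPair SNil SNil, k')" "k' \<le> k + 40" by blast
    ultimately show ?thesis using 0 b
      by (intro exI[of _ "SPair SNil SNil"] exI[of _ k']) auto
  next
    case (Some q)
    then have "\<not> unviolated rs (set M) (set x)" by (auto simp: find_Some_iff unviolated_def)
    moreover have "sym_diff (set x) N = {} \<longleftrightarrow> N = set x" for N by auto
    then have "card (sym_diff (set x) N) \<le> 0 \<longleftrightarrow> N = set x" if "N \<subseteq> set A" for N
      using that by (simp add: finite_subset[OF that])
    moreover have "\<exists>k'. call prog SEARCH [enc_prog rs, syms A, syms M, syms x, unary 0] =
        Some (SNil, k') \<and> k' \<le> k + 40"
      using k(1) Some
      by (subst call_prog) (cases q, simp add: search_body_def call_prog(9) search_at_body_def)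
    then obtain k' where "call prog SEARCH [enc_prog rs, syms A, syms M, syms x, unary 0] =
        Some (SNil, k')" "k' \<le> k + 40" by blast
    ultimately show ?thesis using b by (intro exI[of _ SNil] exI[of _ k']) auto
  qed
next
  case (Suc r x)
  have lx: "length x \<le> s"
    using Suc.prems assms(1,2) by (metis card_mono distinct_card finite_set le_trans)
  obtain k where k: "call prog VIOLATED [enc_prog rs, syms x, syms M] =
      Some (case find (\<lambda>r. violates r (set x) (set M)) rs of None \<Rightarrow> SNil | Some r \<Rightarrow> enc_rule r, k)"
    "real k \<le> 160 * z^3" using call_violated_cube[OF lx assms(3)] by blast
  have t1: "1 \<le> real t ^ Suc r" using t_pos by (intro one_le_power) auto
  have sc: "0 \<le> step_cost" using z_bounds(1) by (simp add: step_cost_def)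
  show ?case
  proof (cases "find (\<lambda>r. violates r (set x) (set M)) rs")
    case None
    have "real k + 40 \<le> 3 * step_cost * 1 * 1" using k(2) z_bounds(5) unfolding step_cost_def by linarith
    also have "\<dots> \<le> 3 * step_cost * (real (Suc r) + 1) * real t ^ Suc r"
      using t1 sc by (intro mult_mono) auto
    finally have "real k + 40 \<le> 3 * step_cost * (real (Suc r) + 1) * real t ^ Suc r" .
    moreover from None have "unviolated rs (set M) (set x)"
      by (auto simp: find_None_iff unviolated_def)
    moreover have "\<exists>k'. call prog SEARCH [enc_prog rs, syms A, syms M, syms x, unary (Suc r)] =
        Some (SPair SNil SNil, k') \<and> k' \<le> k + 40"
      using k(1) None by (subst call_prog) (simp add: search_body_def call_prog(9) search_at_body_def)
    then obtain k' where "call prog SEARCH [enc_prog rs, syms A, syms M, syms x, unary (Suc r)] =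
        Some (SPair SNil SNil, k')" "k' \<le> k + 40" by blast
    ultimately show ?thesis using Suc.prems
      by (intro exI[of _ "SPair SNil SNil"] exI[of _ k']) auto
  next
    case (Some q)
    obtain hs ps ns where q: "q = Rule hs ps ns" by (cases q)
    have qv: "q \<in> set rs" "violates q (set x) (set M)"
      using Some by (auto simp: find_Some_iff in_set_conv_nth)
    let ?B = "3 * step_cost * (real r + 1) * real t ^ r"
    let ?Q = "\<exists>N\<subseteq>set A. unviolated rs (set M) N"
    let ?W = "\<lambda>a. \<exists>N\<subseteq>set A. unviolated rs (set M) N \<and> card (sym_diff (set (toggle a x)) N) \<le> r"
    have B0: "0 \<le> ?B" using sc by simp
    have "\<exists>v k. call prog SEARCH [enc_prog rs, syms A, syms M, syms (toggle a x), unary r] = Some (v, k) \<and>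
      real k \<le> ?B \<and> (v \<noteq> SNil \<longrightarrow> ?Q) \<and> (?W a \<longrightarrow> v \<noteq> SNil)" if "a \<in> set A" for a
      using that Suc.prems by (intro Suc.IH) (auto simp: set_toggle distinct_toggle)
    from call_search_flips[OF assms(2) lx this B0, of "hs @ ps"]
    obtain v k1 where k1:
      "call prog SEARCH_FLIPS [syms (hs @ ps), enc_prog rs, syms A, syms M, syms x, unary r] = Some (v, k1)"
      "real k1 \<le> length (hs @ ps) * (?B + 80 * z) + 3" "v \<noteq> SNil \<longrightarrow> ?Q"
      "(\<exists>a\<in>set (hs @ ps). a \<in> set A \<and> ?W a) \<longrightarrow> v \<noteq> SNil" by blast
    obtain k2 where k2: "call prog APPEND [syms hs, syms ps] = Some (syms (hs @ ps), k2)"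
      "k2 \<le> 20 * (length hs + 1)" using call_append by blast
    have "\<exists>k'. call prog SEARCH [enc_prog rs, syms A, syms M, syms x, unary (Suc r)] =
        Some (v, k') \<and> real k' \<le> real k + k1 + k2 + 40"
      using k(1) k1(1) k2(1) Some q
      by (subst call_prog) (simp add: search_body_def call_prog(9) search_at_body_def)
    then obtain k' where k': "call prog SEARCH [enc_prog rs, syms A, syms M, syms x, unary (Suc r)] =
        Some (v, k')" "real k' \<le> real k + k1 + k2 + 40"
      by blast
    have "length (hs @ ps) \<le> t" "length hs \<le> s"
      using rule_length_le_t[OF qv(1)] rule_length_le_s[OF qv(1)] by (auto simp: q rule_length_def)
    then have "real k2 \<le> 20 * z"
      and "length (hs @ ps) * (?B + 80 * z) \<le> real t * (?B + 80 * z)"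
      using linear_cost[OF k2(2)] B0 by (simp, intro mult_right_mono) auto
    moreover have "real t * (80 * z) \<le> real t * step_cost"
      unfolding step_cost_def using z_bounds by (intro mult_left_mono) linarith+
    ultimately have "real k' \<le> step_cost + real t * ?B + real t * step_cost"
      using k'(2) k1(2) k(2) z_bounds unfolding step_cost_def distrib_left by linarith
    \<comment> \<open>Each level contributes at most \<open>3 * step_cost * t ^ Suc r\<close>, hence
      the linear factor in the radius.\<close>
    also have "\<dots> \<le> real t ^ Suc r * step_cost + real t * ?B + 2 * (real t ^ Suc r * step_cost)"
    proof -
      have "1 * step_cost \<le> real t ^ Suc r * step_cost" using t1 sc by (intro mult_right_mono) auto
      moreover have "real t * step_cost \<le> real t ^ Suc r * step_cost"
        using t_pos sc by (intro mult_right_mono self_le_power) auto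
      moreover have "0 \<le> real t ^ Suc r * step_cost" using sc by simp
      ultimately show ?thesis by linarith
    qed
    also have "\<dots> = 3 * step_cost * (real (Suc r) + 1) * real t ^ Suc r" by (simp add: algebra_simps)
    finally have cost: "real k' \<le> 3 * step_cost * (real (Suc r) + 1) * real t ^ Suc r" .
    have "v \<noteq> SNil"
      if N: "N \<subseteq> set A" "unviolated rs (set M) N" "card (sym_diff (set x) N) \<le> Suc r" for N
    proof -
      have "\<not> violates q N (set M)" using N(2) qv(1) by (simp add: unviolated_def)
      \<comment> \<open>A rule violated by the word but not by \<open>N\<close> has an atom in its
        head or positive body on which the two differ; toggling it brings the word one step closer
        to \<open>N\<close>.\<close>
      then obtain a where a: "a \<in> set (hs @ ps)" "a \<in> sym_diff (set x) N"
        using qv(2) by (auto simp: violates_def q)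
      have "finite (sym_diff (set x) N)" using N(1) finite_subset by auto
      moreover have "sym_diff (set (toggle a x)) N = sym_diff (set x) N - {a}"
        using Suc.prems(1) a(2) by (auto simp: set_toggle)
      ultimately have "card (sym_diff (set (toggle a x)) N) \<le> r" using N(3) a(2) by simp
      moreover have "a \<in> set A" using a(2) N(1) Suc.prems(2) by auto
      ultimately show ?thesis using k1(4) a(1) N(1,2) by blast
    qed
    then show ?thesis using k'(1) cost k1(3) by (intro exI[of _ v] exI[of _ k']) auto
  qed
qed

end

section \<open>Search from the words of a covering code\<close>

text \<open>\<open>zip\<close> truncates, so a codeword longer than the remaining atoms loses its
  tail, as in \<open>BLOCK\<close>.\<close>

definition pick :: "bool list \<Rightarrow> 'a list \<Rightarrow> 'a list" where
  "pick c A = map snd (filter fst (zip c A))"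

lemma set_pick: "set (pick c A) = {A ! i |i. i < length c \<and> i < length A \<and> c ! i}"
  unfolding pick_def by (auto simp: set_zip image_iff) blast

lemma distinct_pick: "distinct A \<Longrightarrow> distinct (pick c A)"
proof (induction A arbitrary: c)
  case (Cons a A)
  then show ?case by (cases c) (auto simp: pick_def dest: set_zip_rightD)
qed (simp add: pick_def)

text \<open>Only an inequality: positions of the codeword beyond the end of \<open>A\<close> may
  differ from \<open>w\<close>, but they select no atom.\<close>

lemma card_sym_diff_pick:
  assumes "\<And>i. i < length c \<Longrightarrow> w ! i \<longleftrightarrow> i < length A \<and> A ! i \<in> N"
  shows "card (sym_diff (set (pick c A)) (N \<inter> set (take (length c) A))) \<le>
    card {i. i < length c \<and> c ! i \<noteq> w ! i}"
proof (rule surj_card_le)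
  show "sym_diff (set (pick c A)) (N \<inter> set (take (length c) A)) \<subseteq>
      (\<lambda>i. A ! i) ` {i. i < length c \<and> c ! i \<noteq> w ! i}"
    using assms by (fastforce simp: set_pick in_set_conv_nth)
qed simp

text \<open>\<open>\<beta>\<close> is the price per atom: by \<open>code_size\<close>, the number of
  codewords times the \<open>t ^ rho\<close> of one ball search is at most
  \<open>\<beta> ^ b\<close> for a block of \<open>b\<close> atoms.\<close>

locale bounded_code = bounded_input +
  fixes b :: nat and \<beta> :: real and quote_cost :: nat
  assumes b_pos: "0 < b" and length_codeword: "c \<in> set code \<Longrightarrow> length c = b"
    and covering: "length w = b \<Longrightarrow> \<exists>c\<in>set code. card {i. i < b \<and> c ! i \<noteq> w ! i} \<le> rho"
    and code_size: "real (length code) * real t ^ rho \<le> \<beta> ^ b"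
    and quote: "ev p env (quote_list (quote_list quote_bool) code) =
      Some (enc_list (enc_list sbool) code, quote_cost)"
begin

lemma call_block:
  assumes "call prog CENTRES [syms (drop (length c) A), syms (rev (pick c A) @ x), r, R, A0, M] = Some (v, k)"
  shows "\<exists>k'. call prog BLOCK [enc_list sbool c, syms A, syms x, r, R, A0, M] = Some (v, k') \<and>
    k' \<le> k + 40 * (length c + 1)"
  using assms
proof (induction c arbitrary: A x)
  case Nil
  then show ?case by (subst call_prog) (simp add: block_body_def pick_def)
next
  case (Cons f c)
  show ?case
  proof (cases A)
    case Nil
    then show ?thesis using Cons.prems by (subst call_prog) (simp add: block_body_def pick_def)
  next
    case (Cons a A')
    have "call prog CENTRES [syms (drop (length c) A'), syms (rev (pick c A') @ (if f then a # x else x)),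
        r, R, A0, M] = Some (v, k)" using Cons.prems Cons by (simp add: pick_def split: if_splits)
    from Cons.IH[OF this] obtain k' where k':
      "call prog BLOCK [enc_list sbool c, syms A', syms (if f then a # x else x), r, R, A0, M] = Some (v, k')"
      "k' \<le> k + 40 * (length c + 1)" by blast
    then show ?thesis unfolding Cons
      by (subst call_prog) (cases f, simp_all add: block_body_def)
  qed
qed

lemma call_codewords:
  fixes B :: real
  assumes "\<And>c. c \<in> set cs \<Longrightarrow> \<exists>v k. call prog BLOCK [enc c, A, x, r, R, A0, M] = Some (v, k) \<and>
      real k \<le> B \<and> (v \<noteq> SNil \<longrightarrow> Q) \<and> (W c \<longrightarrow> v \<noteq> SNil)"
  shows "\<exists>v k. call prog CODEWORDS [enc_list enc cs, A, x, r, R, A0, M] = Some (v, k) \<and>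
      real k \<le> length cs * (B + 30) + 3 \<and> (v \<noteq> SNil \<longrightarrow> Q) \<and> ((\<exists>c\<in>set cs. W c) \<longrightarrow> v \<noteq> SNil)"
  using assms
proof (induction cs)
  case Nil
  show ?case by (subst call_prog) (simp add: codewords_body_def)
next
  case (Cons c cs)
  then obtain v k where k: "call prog CODEWORDS [enc_list enc cs, A, x, r, R, A0, M] = Some (v, k)"
    "real k \<le> length cs * (B + 30) + 3" "v \<noteq> SNil \<longrightarrow> Q" "(\<exists>c\<in>set cs. W c) \<longrightarrow> v \<noteq> SNil"
    by (metis list.set_intros(2))
  obtain v' k' where k': "call prog BLOCK [enc c, A, x, r, R, A0, M] = Some (v', k')"
    "real k' \<le> B" "v' \<noteq> SNil \<longrightarrow> Q" "W c \<longrightarrow> v' \<noteq> SNil" using Cons.prems[of c] by auto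
  have "real k + k' + 30 \<le> length (c # cs) * (B + 30) + 3"
    using k(2) k'(2) by (simp add: algebra_simps)
  moreover have "\<exists>w k''. call prog CODEWORDS [enc_list enc (c # cs), A, x, r, R, A0, M] = Some (w, k'') \<and>
      real k'' \<le> real k + k' + 30 \<and> (w = SNil \<longleftrightarrow> v' = SNil \<and> v = SNil)"
    using k(1) k'(1) by (subst call_prog) (simp add: codewords_body_def)
  then obtain w k'' where "call prog CODEWORDS [enc_list enc (c # cs), A, x, r, R, A0, M] = Some (w, k'')"
      "real k'' \<le> real k + k' + 30" "w = SNil \<longleftrightarrow> v' = SNil \<and> v = SNil" by blast
  ultimately show ?case using k k' by (intro exI[of _ w] exI[of _ k'']) auto
qed

text \<open>In \<open>call_centres\<close> no radius exceeds \<open>rho * s\<close>, so the first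
  summand covers the polynomial factor of a ball search. The second bounds the overhead of one
  \<open>CENTRES\<close> call, shared out over the codewords.\<close>

definition search_cost :: real where
  "search_cost = 3 * step_cost * (real rho * z + 1) + (quote_cost + 2 * rho + 40 * b + 200)"

text \<open>A last block that is cut off still costs a full \<open>\<beta> ^ b\<close>; the surplus
  \<open>b\<close> in the exponent pays for it.\<close>

definition blocks_cost :: "nat \<Rightarrow> real" where
  "blocks_cost l = (if l = 0 then 1 else \<beta> ^ (l + b))"

lemma code_nonempty: "1 \<le> length code"
  using covering[of "replicate b True"] by (cases code) auto

lemma step_cost_nonneg: "0 \<le> step_cost"
  using z_bounds(1) by (simp add: step_cost_def)

lemma search_cost_bounds:
  "0 \<le> search_cost" "real (quote_cost + 2 * rho + 40 * b + 200) \<le> search_cost"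
proof -
  have "0 \<le> 3 * step_cost * (real rho * z + 1)"
    using z_bounds(1) step_cost_nonneg by simp
  then show "0 \<le> search_cost" "real (quote_cost + 2 * rho + 40 * b + 200) \<le> search_cost"
    by (simp_all add: search_cost_def)
qed

lemma beta_ge_1: "1 \<le> \<beta>" if "0 \<le> \<beta>"
proof -
  have "1 * 1 \<le> real (length code) * real t ^ rho"
    using code_nonempty t_pos by (intro mult_mono one_le_power) auto
  then have "1 ^ b \<le> \<beta> ^ b" using code_size by simp
  then show ?thesis using that b_pos power_le_imp_le_base by (metis power_mono_iff zero_le_one)
qed

text \<open>The distance to a model \<open>N\<close> is measured on the decided atoms only, hence
  \<open>N - set A\<close>; on the next block some codeword adds at most \<open>rho\<close> to it.
  The premise on \<open>r\<close> bounds the final radius by \<open>rho * s\<close>: it allows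
  \<open>rho\<close> per undecided atom, while each block uses up at least one atom.\<close>

lemma call_centres:
  assumes A0: "distinct A0" "length A0 \<le> s" "length M \<le> s" and \<beta>: "0 \<le> \<beta>"
  shows "\<lbrakk>distinct A; distinct x; set A \<subseteq> set A0; set x \<subseteq> set A0; set x \<inter> set A = {};
      r + rho * length A \<le> rho * s\<rbrakk> \<Longrightarrow>
    \<exists>v k. call prog CENTRES [syms A, syms x, unary r, enc_prog rs, syms A0, syms M] = Some (v, k) \<and>
      real k \<le> search_cost * (real (length A) + 1) * real t ^ r * blocks_cost (length A) \<and>
      (v \<noteq> SNil \<longrightarrow> (\<exists>N\<subseteq>set A0. unviolated rs (set M) N)) \<and>
      ((\<exists>N\<subseteq>set A0. unviolated rs (set M) N \<and> card (sym_diff (set x) (N - set A)) \<le> r) \<longrightarrow>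
        v \<noteq> SNil)"
proof (induction "length A" arbitrary: A x r rule: less_induct)
  case less
  have tr: "1 \<le> real t ^ r" using t_pos by (intro one_le_power) auto
  show ?case
  proof (cases "A = []")
    case True
    obtain v k where k: "call prog SEARCH [enc_prog rs, syms A0, syms M, syms x, unary r] = Some (v, k)"
      "real k \<le> 3 * step_cost * (real r + 1) * real t ^ r"
      "v \<noteq> SNil \<longrightarrow> (\<exists>N\<subseteq>set A0. unviolated rs (set M) N)"
      "(\<exists>N\<subseteq>set A0. unviolated rs (set M) N \<and> card (sym_diff (set x) N) \<le> r) \<longrightarrow> v \<noteq> SNil"
      using call_search[where r = r, OF A0 less.prems(2,4)] by (elim exE conjE) (rule that)
    have "\<exists>k'. call prog CENTRES [syms A, syms x, unary r, enc_prog rs, syms A0, syms M] = Some (v, k') \<and>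
        real k' \<le> real k + 20" using k(1) True by (subst call_prog) (simp add: centres_body_def)
    then obtain k' where k': "call prog CENTRES [syms A, syms x, unary r, enc_prog rs, syms A0, syms M] =
        Some (v, k')" "real k' \<le> real k + 20" by blast
    have "real r + 1 \<le> real rho * z + 1"
    proof -
      have "real r \<le> real (rho * s)" using less.prems(6) by (simp only: of_nat_le_iff)
      also have "\<dots> \<le> real rho * z" by (simp add: z_def mult_left_mono)
      finally show ?thesis by simp
    qed
    then have "3 * step_cost * (real r + 1) * real t ^ r \<le>
        3 * step_cost * (real rho * z + 1) * real t ^ r"
      using step_cost_nonneg by (intro mult_right_mono mult_left_mono) auto
    moreover have "20 * 1 \<le> real (quote_cost + 2 * rho + 40 * b + 200) * real t ^ r"
      using tr by (intro mult_mono) auto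
    ultimately have "real k' \<le> search_cost * real t ^ r"
      using k(2) k'(2) unfolding search_cost_def distrib_right by linarith
    then have "real k' \<le> search_cost * (real (length A) + 1) * real t ^ r * blocks_cost (length A)"
      using True by (simp add: blocks_cost_def)
    then show ?thesis using k(3,4) k'(1) unfolding True
      by (intro exI[of _ v] exI[of _ k'] conjI) simp_all
  next
    case False
    define A' where "A' = drop b A"
    define l where "l = length A"
    define l' where "l' = length A'"
    have l: "l' < l" "l' = l - b" using False b_pos by (auto simp: A'_def l_def l'_def)
    define B where "B = search_cost * (real l' + 1) * real t ^ (rho + r) * blocks_cost l'"
    let ?Q = "\<exists>N\<subseteq>set A0. unviolated rs (set M) N"
    let ?W = "\<lambda>c. \<exists>N\<subseteq>set A0. unviolated rs (set M) N \<and>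
        card (sym_diff (set (rev (pick c A) @ x)) (N - set A')) \<le> rho + r"
    have "\<exists>v k. call prog BLOCK [enc_list sbool c, syms A, syms x, unary (rho + r), enc_prog rs,
        syms A0, syms M] = Some (v, k) \<and> real k \<le> B + 40 * (real b + 1) \<and> (v \<noteq> SNil \<longrightarrow> ?Q) \<and>
        (?W c \<longrightarrow> v \<noteq> SNil)" if c: "c \<in> set code" for c
    proof -
      have lc: "length c = b" using c by (rule length_codeword)
      have sub: "set (pick c A) \<subseteq> set (take b A)"
        by (force simp: set_pick lc in_set_conv_nth)
      have disj: "set (take b A) \<inter> set A' = {}" unfolding A'_def
        using less.prems(1) by (rule set_take_disj_set_drop_if_distinct) simp
      have sub': "set (take b A) \<subseteq> set A" "set A' \<subseteq> set A"
        unfolding A'_def by (rule set_take_subset, rule set_drop_subset)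
      have "length A' < length A" using l(1) unfolding l_def l'_def .
      moreover have "distinct A'" using less.prems(1) by (simp add: A'_def)
      moreover have "distinct (rev (pick c A) @ x)"
        using less.prems(1,2,5) sub sub'(1) distinct_pick by auto
      moreover have "set A' \<subseteq> set A0" "set (rev (pick c A) @ x) \<subseteq> set A0"
        "set (rev (pick c A) @ x) \<inter> set A' = {}"
        using less.prems(3-5) sub sub' disj by auto
      moreover have "rho + r + rho * length A' \<le> rho * s"
      proof -
        have "rho * (length A' + 1) \<le> rho * length A"
          using \<open>length A' < length A\<close> by (intro mult_le_mono) auto
        then show ?thesis using less.prems(6) unfolding distrib_left by linarith
      qed
      ultimately have rec: "length A' < length A" "distinct A'" "distinct (rev (pick c A) @ x)"
        "set A' \<subseteq> set A0" "set (rev (pick c A) @ x) \<subseteq> set A0"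
        "set (rev (pick c A) @ x) \<inter> set A' = {}" "rho + r + rho * length A' \<le> rho * s" by blast+
      from less.hyps[OF rec, folded l'_def, folded B_def] obtain v k where k: "call prog CENTRES [syms A', syms (rev (pick c A) @ x),
          unary (rho + r), enc_prog rs, syms A0, syms M] = Some (v, k)" "real k \<le> B"
        "v \<noteq> SNil \<longrightarrow> ?Q" "?W c \<longrightarrow> v \<noteq> SNil"
        by (elim exE conjE) (rule that)
      from call_block[of c A x, unfolded lc, folded A'_def, OF k(1)] obtain k' where
        "call prog BLOCK [enc_list sbool c, syms A, syms x, unary (rho + r), enc_prog rs,
          syms A0, syms M] = Some (v, k')" "k' \<le> k + 40 * (b + 1)" by blast
      moreover from this(2) have "real k' \<le> real (k + 40 * (b + 1))" by (simp only: of_nat_le_iff)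
      ultimately show ?thesis using k by (intro exI[of _ v] exI[of _ k']) auto
    qed
    from call_codewords[where cs = code and enc = "enc_list sbool" and W = ?W, OF this] obtain v k where
      k: "call prog CODEWORDS [enc_list (enc_list sbool) code, syms A, syms x, unary (rho + r),
        enc_prog rs, syms A0, syms M] = Some (v, k)"
      "real k \<le> length code * (B + 40 * (real b + 1) + 30) + 3" "v \<noteq> SNil \<longrightarrow> ?Q"
      "(\<exists>c\<in>set code. ?W c) \<longrightarrow> v \<noteq> SNil" by blast
    have "ev prog [syms A, syms x, unary r, enc_prog rs, syms A0, syms M]
        ((Cons_of Null ^^ rho) (Arg 2)) = Some (unary (rho + r), 2 * rho + 1)"
      by (rule ev_add_unary) simp
    then have "\<exists>k'. call prog CENTRES [syms A, syms x, unary r, enc_prog rs, syms A0, syms M] =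
        Some (v, k') \<and> real k' \<le> real k + quote_cost + 2 * rho + 40"
      using k(1) False by (subst call_prog) (cases A, auto simp: centres_body_def quote)
    then obtain k' where k': "call prog CENTRES [syms A, syms x, unary r, enc_prog rs, syms A0, syms M] =
        Some (v, k')" "real k' \<le> real k + quote_cost + 2 * rho + 40" by blast
    have "real k' \<le> real (length code) * B + (real (length code) * (40 * real b + 70) +
        1 * (quote_cost + 2 * rho + 43))"
      using k'(2) k(2) by (simp add: algebra_simps)
    also have "\<dots> \<le> real (length code) * B + (real (length code) * (40 * real b + 70) +
        real (length code) * (quote_cost + 2 * rho + 43))"
      using code_nonempty by (intro add_left_mono mult_right_mono) auto
    also have "\<dots> \<le> real (length code) * (B + search_cost)"
      unfolding distrib_left[symmetric]
      using search_cost_bounds(2) by (intro mult_left_mono) auto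
    \<comment> \<open>The overhead of this level is absorbed by the factor
      \<open>length A + 1\<close>, which drops by at least one per block.\<close>
    also have "\<dots> \<le> real (length code) * (B + search_cost * real t ^ (rho + r) * blocks_cost l')"
    proof -
      have "1 * 1 \<le> real t ^ (rho + r) * blocks_cost l'"
        using t_pos beta_ge_1[OF \<beta>] by (intro mult_mono one_le_power) (auto simp: blocks_cost_def)
      then have "search_cost * 1 \<le> search_cost * (real t ^ (rho + r) * blocks_cost l')"
        using search_cost_bounds(1) by (intro mult_left_mono) auto
      then show ?thesis by (intro mult_left_mono) auto
    qed
    also have "\<dots> = (real (length code) * real t ^ rho) *
        (search_cost * (real l' + 2) * real t ^ r * blocks_cost l')"
      by (simp add: B_def algebra_simps power_add)
    also have "\<dots> \<le> \<beta> ^ b * (search_cost * (real l + 1) * real t ^ r * blocks_cost l')"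
    proof (intro mult_mono code_size)
      show "real l' + 2 \<le> real l + 1" using l(1) by linarith
    qed (use search_cost_bounds(1) \<beta> in \<open>auto simp: blocks_cost_def\<close>)
    also have "\<dots> = search_cost * (real l + 1) * real t ^ r * (\<beta> ^ b * blocks_cost l')"
      by simp
    also have "\<dots> \<le> search_cost * (real l + 1) * real t ^ r * blocks_cost l"
    proof (intro mult_left_mono)
      show "\<beta> ^ b * blocks_cost l' \<le> blocks_cost l"
      proof (cases "l' = 0")
        case True
        then show ?thesis using l(1) beta_ge_1[OF \<beta>]
          by (auto simp: blocks_cost_def intro!: power_increasing)
      next
        case False
        then show ?thesis using l by (auto simp: blocks_cost_def add.commute simp flip: power_add)
      qed
    qed (use search_cost_bounds(1) in auto)
    finally have cost: "real k' \<le> search_cost * (real l + 1) * real t ^ r * blocks_cost l" .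
    have "v \<noteq> SNil" if N: "N \<subseteq> set A0" "unviolated rs (set M) N"
      "card (sym_diff (set x) (N - set A)) \<le> r" for N
    proof -
      \<comment> \<open>The trace of \<open>N\<close> on the next block, padded with
        \<open>False\<close> if fewer than \<open>b\<close> atoms are left.\<close>
      define w where "w = map (\<lambda>i. i < length A \<and> A ! i \<in> N) [0..<b]"
      obtain c where c: "c \<in> set code" "card {i. i < b \<and> c ! i \<noteq> w ! i} \<le> rho"
        using covering[of w] by (auto simp: w_def)
      have lc: "length c = b" using c(1) by (rule length_codeword)
      have d: "card (sym_diff (set (pick c A)) (N \<inter> set (take b A))) \<le> rho"
        using card_sym_diff_pick[of c w A N] c(2) by (simp add: lc w_def)
      have "sym_diff (set (rev (pick c A) @ x)) (N - set A') \<subseteq>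
          sym_diff (set (pick c A)) (N \<inter> set (take b A)) \<union> sym_diff (set x) (N - set A)"
      proof -
        have "set A = set (take b A) \<union> set A'" unfolding A'_def by (metis append_take_drop_id set_append)
        moreover have "set (pick c A) \<subseteq> set (take b A)"
          by (force simp: set_pick lc in_set_conv_nth)
        moreover have "set (take b A) \<inter> set A' = {}" unfolding A'_def
          using less.prems(1) by (rule set_take_disj_set_drop_if_distinct) simp
        ultimately show ?thesis by auto
      qed
      moreover have "finite N" using N(1) finite_subset by blast
      then have "finite (sym_diff (set (pick c A)) (N \<inter> set (take b A)) \<union> sym_diff (set x) (N - set A))"
        by simp
      ultimately have "card (sym_diff (set (rev (pick c A) @ x)) (N - set A')) \<le>
          card (sym_diff (set (pick c A)) (N \<inter> set (take b A)) \<union> sym_diff (set x) (N - set A))"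
        by (intro card_mono)
      also have "\<dots> \<le> card (sym_diff (set (pick c A)) (N \<inter> set (take b A))) +
          card (sym_diff (set x) (N - set A))" by (rule card_Un_le)
      also have "\<dots> \<le> rho + r" using N(3) d by (intro add_mono)
      finally have "card (sym_diff (set (rev (pick c A) @ x)) (N - set A')) \<le> rho + r" .
      then show ?thesis using k(4) c(1) N(1,2) by blast
    qed
    then show ?thesis using k'(1) cost k(3) unfolding l_def
      by (intro exI[of _ v] exI[of _ k'] conjI) auto
  qed
qed

end

section \<open>Enumeration of answer sets\<close>

lemma answer_set_iff:
  "answer_set (set rs) M \<longleftrightarrow> unviolated rs M M \<and> (\<forall>N. N \<subset> M \<longrightarrow> \<not> unviolated rs M N)"
proof -
  have "prog_model (gl_reduct (set rs) M) N \<longleftrightarrow>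
      (\<forall>r\<in>set rs. set (neg_body r) \<inter> M = {} \<longrightarrow> sat_rule N (Rule (head r) (pos_body r) []))" for N
    by (auto simp: prog_model_def gl_reduct_def)
  then have "prog_model (gl_reduct (set rs) M) N \<longleftrightarrow> unviolated rs M N" for N
    by (auto simp: unviolated_def violates_def sat_rule_def)
  then show ?thesis by (simp add: answer_set_def minimal_model_def)
qed

lemma answer_set_iff_delete_atom:
  "answer_set (set rs) M \<longleftrightarrow>
     unviolated rs M M \<and> (\<forall>a\<in>M. \<not> (\<exists>N\<subseteq>M - {a}. unviolated rs M N))"
  unfolding answer_set_iff by blast

lemma unviolated_antimono: "unviolated rs M N \<Longrightarrow> M \<subseteq> M' \<Longrightarrow> unviolated rs M' N"
  unfolding unviolated_def violates_def by blast

text \<open>\<open>X\<close> is a model of its own reduct and hence of the smaller reduct by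
  \<open>M\<close>, so minimality of \<open>M\<close> rules out \<open>X \<subset> M\<close>. This
  makes a node without violated rule a leaf.\<close>

lemma answer_set_eq_if_unviolated:
  "answer_set (set rs) M \<Longrightarrow> unviolated rs X X \<Longrightarrow> X \<subseteq> M \<Longrightarrow> M = X"
  using unviolated_antimono[of rs X X M] unfolding answer_set_iff by blast

lemma enumerates_append:
  assumes "enumerates Ms F" "enumerates Ns G" "F \<inter> G = {}"
  shows "enumerates (Ms @ Ns) (F \<union> G)"
  using assms unfolding enumerates_def by auto

lemma enc_atom_lists_simps:
  "enc_atom_lists [] = SNil" "enc_atom_lists (x # xs) = SPair (syms x) (enc_atom_lists xs)"
  by (simp_all add: enc_atom_lists_def)

context bounded_code
begin

section \<open>The minimality test and one branching step\<close>

lemma call_minimal: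
  assumes "distinct M" "length M \<le> s" "0 \<le> \<beta>"
  shows "set L \<subseteq> set M \<Longrightarrow> \<exists>v k. call prog MINIMAL [syms L, syms M, enc_prog rs] = Some (v, k) \<and>
    real k \<le> length L * (search_cost * z * \<beta> ^ (length M + b) + 100 * z) + 5 \<and>
    (v \<noteq> SNil \<longleftrightarrow> (\<forall>a\<in>set L. \<not> (\<exists>N\<subseteq>set M - {a}. unviolated rs (set M) N)))"
proof (induction L)
  case Nil
  show ?case by (subst call_prog) (simp add: minimal_body_def)
next
  case (Cons a L)
  have a: "a \<in> set M" using Cons.prems by simp
  obtain v k where k: "call prog MINIMAL [syms L, syms M, enc_prog rs] = Some (v, k)"
    "real k \<le> length L * (search_cost * z * \<beta> ^ (length M + b) + 100 * z) + 5"
    "v \<noteq> SNil \<longleftrightarrow> (\<forall>a\<in>set L. \<not> (\<exists>N\<subseteq>set M - {a}. unviolated rs (set M) N))"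
    using Cons by auto
  obtain k1 where k1: "call prog TOGGLE [SSym a, syms M] = Some (syms (toggle a M), k1)"
    "k1 \<le> 20 * (length M + 1)" using call_toggle by blast
  define A where "A = toggle a M"
  have A: "distinct A" "set A = set M - {a}"
    using assms(1) a by (auto simp: A_def set_toggle distinct_toggle)
  have len: "length A + 1 = length M"
    using A assms(1) a by (metis card_Suc_Diff1 distinct_card finite_set Suc_eq_plus1)
  have "length A \<le> s" "0 + rho * length A \<le> rho * s" using len assms(2) by (auto intro: mult_le_mono2)
  from call_centres[where x = "[]" and r = 0, OF A(1) this(1) assms(2,3) A(1) _ _ _ _ this(2), simplified]
  have "\<exists>v k. call prog CENTRES [syms A, SNil, SNil, enc_prog rs, syms A, syms M] = Some (v, k) \<and>
    real k \<le> search_cost * (real (length A) + 1) * blocks_cost (length A) \<and>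
    (v \<noteq> SNil \<longrightarrow> (\<exists>N\<subseteq>set A. unviolated rs (set M) N)) \<and>
    ((\<exists>N\<subseteq>set A. unviolated rs (set M) N \<and> card (N - set A) = 0) \<longrightarrow> v \<noteq> SNil)"
    by simp
  then obtain v' k' where k': "call prog CENTRES [syms A, SNil, SNil, enc_prog rs, syms A, syms M] = Some (v', k')"
    "real k' \<le> search_cost * (real (length A) + 1) * blocks_cost (length A)"
    "v' \<noteq> SNil \<longrightarrow> (\<exists>N\<subseteq>set A. unviolated rs (set M) N)"
    "(\<exists>N\<subseteq>set A. unviolated rs (set M) N \<and> card (N - set A) = 0) \<longrightarrow> v' \<noteq> SNil"
    by (elim exE conjE) (rule that)
  \<comment> \<open>Before any atom is decided, every \<open>N \<subseteq> set A\<close> is at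
    distance 0, so the one-sided answers combine to an equivalence.\<close>
  have "card (N - set A) = 0" if "N \<subseteq> set A" for N
    using that by (simp add: Diff_eq_empty_iff[THEN iffD2])
  then have v': "v' \<noteq> SNil \<longleftrightarrow> (\<exists>N\<subseteq>set A. unviolated rs (set M) N)" using k'(3,4) by blast
  have "blocks_cost (length A) \<le> \<beta> ^ (length M + b)"
    using len beta_ge_1[OF assms(3)] by (auto simp: blocks_cost_def intro!: power_increasing)
  moreover have "real (length A) + 1 \<le> z" using len assms(2) by (simp add: z_def)
  ultimately have "real k' \<le> search_cost * z * \<beta> ^ (length M + b)"
    using k'(2) search_cost_bounds(1) z_bounds(1) beta_ge_1[OF assms(3)]
    by (elim order_trans) (intro mult_mono, auto simp: blocks_cost_def)
  moreover have "real k1 \<le> 20 * z" using linear_cost k1(2) assms(2) by blast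
  ultimately have "real k + k' + 2 * k1 + 50 \<le>
      length (a # L) * (search_cost * z * \<beta> ^ (length M + b) + 100 * z) + 5"
    using k(2) z_bounds(1) by (simp add: algebra_simps)
  moreover have "\<exists>w k''. call prog MINIMAL [syms (a # L), syms M, enc_prog rs] = Some (w, k'') \<and>
      real k'' \<le> real k + k' + 2 * k1 + 50 \<and> (w \<noteq> SNil \<longleftrightarrow> v' = SNil \<and> v \<noteq> SNil)"
    using k(1) k'(1) k1(1) by (subst call_prog) (simp add: minimal_body_def A_def)
  then obtain w k'' where "call prog MINIMAL [syms (a # L), syms M, enc_prog rs] = Some (w, k'')"
      "real k'' \<le> real k + k' + 2 * k1 + 50" "w \<noteq> SNil \<longleftrightarrow> v' = SNil \<and> v \<noteq> SNil" by blast
  ultimately show ?case using k(3) v' A(2)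
    by (intro exI[of _ w] exI[of _ k''] conjI) auto
qed

text \<open>The share of a node's budget taken by its first \<open>j\<close> children: child
  \<open>i\<close>, counted from 0, has one more true atom (factor \<open>\<beta>\<close>) and
  \<open>i + 1\<close> fewer undecided atoms.\<close>

definition branch_sum :: "real \<Rightarrow> nat \<Rightarrow> real" where
  "branch_sum \<gamma> j = (\<Sum>i<j. \<beta> / \<gamma> ^ Suc i)"

lemma branch_sum_0: "branch_sum \<gamma> 0 = 0"
  by (simp add: branch_sum_def)

text \<open>Mirrors \<open>ENUM_BRANCH\<close>: the child with the first atom true, and the
  remaining branches, which all start with one undecided atom fewer.\<close>

lemma branch_sum_Suc:
  "branch_sum \<gamma> (Suc j) = \<beta> / \<gamma> + branch_sum \<gamma> j / \<gamma>"
  unfolding branch_sum_def sum.lessThan_Suc_shift by (simp add: sum_divide_distrib mult.commute)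

lemma branch_sum_mono:
  "0 \<le> \<beta> \<Longrightarrow> 0 < \<gamma> \<Longrightarrow> i \<le> j \<Longrightarrow> branch_sum \<gamma> i \<le> branch_sum \<gamma> j"
  unfolding branch_sum_def by (intro sum_mono2) auto

abbreviation answer_sets_between :: "atom list \<Rightarrow> atom list \<Rightarrow> atom set set" where
  "answer_sets_between Tr Fa \<equiv> {M. answer_set (set rs) M \<and> set Tr \<subseteq> M \<and> set Fa \<inter> M = {}}"

text \<open>The recursive calls of \<open>ENUM\<close> are the hypothesis \<open>cand\<close>. The
  lower bound \<open>fmin\<close> on the number of false atoms lets \<open>call_enum\<close> show
  that they concern nodes with fewer undecided atoms than its own.\<close>

lemma call_enum_branch:
  assumes \<beta>: "0 \<le> \<beta>" and \<gamma>: "1 \<le> \<gamma>" and "0 \<le> Q"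
    and U: "finite U" "card U \<le> s" and Tr: "distinct Tr" "set Tr \<subseteq> U"
    and cand: "\<And>a Fa acc. \<lbrakk>a \<in> U - set Tr - set Fa; distinct Fa; set Fa \<subseteq> U - set Tr;
        length Fa \<ge> fmin\<rbrakk> \<Longrightarrow>
      \<exists>Ms k. call prog ENUM [enc_prog rs, syms (a # Tr), syms Fa, enc_atom_lists acc] =
          Some (enc_atom_lists (Ms @ acc), k) \<and>
        real k \<le> Q * real (card (U - set Tr - set Fa)) * \<beta> ^ (length Tr + 1) *
          \<gamma> ^ (card (U - set Tr - set Fa) - 1) \<and>
        enumerates Ms (answer_sets_between (a # Tr) Fa)"
  shows "\<lbrakk>set as \<subseteq> U - set Tr; distinct Fa; set Fa \<subseteq> U - set Tr; length Fa \<ge> fmin\<rbrakk> \<Longrightarrow>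
    \<exists>Ms k. call prog ENUM_BRANCH [syms as, enc_prog rs, syms Tr, syms Fa, enc_atom_lists acc] =
        Some (enc_atom_lists (Ms @ acc), k) \<and>
      real k \<le> length as * (80 * z) + 3 + Q * real (card (U - set Tr - set Fa)) * \<beta> ^ length Tr *
        \<gamma> ^ card (U - set Tr - set Fa) * branch_sum \<gamma> (length as) \<and>
      enumerates Ms (answer_sets_between Tr Fa \<inter> {M. set as \<inter> M \<noteq> {}})"
proof (induction as arbitrary: Fa)
  case Nil
  show ?case
    by (subst call_prog) (auto simp: enum_branch_body_def branch_sum_0 enumerates_def intro: exI[of _ "[]"])
next
  case (Cons a as)
  let ?d = "card (U - set Tr - set Fa)"
  obtain k1 where k1: "call prog MEM [SSym a, syms Fa] = Some (sbool (a \<in> set Fa), k1)"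
    "k1 \<le> 20 * (length Fa + 1)" using call_mem by blast
  have "length Fa \<le> s"
    using Cons.prems(2,3) U by (metis Diff_subset card_mono distinct_card order_trans)
  then have k1': "real k1 \<le> 20 * z" using linear_cost k1(2) by blast
  show ?case
  proof (cases "a \<in> set Fa")
    case True
    from Cons.IH[of Fa] Cons.prems obtain Ms k where
      k: "call prog ENUM_BRANCH [syms as, enc_prog rs, syms Tr, syms Fa, enc_atom_lists acc] =
        Some (enc_atom_lists (Ms @ acc), k)"
      "real k \<le> length as * (80 * z) + 3 + Q * real ?d * \<beta> ^ length Tr * \<gamma> ^ ?d *
        branch_sum \<gamma> (length as)"
      "enumerates Ms (answer_sets_between Tr Fa \<inter> {M. set as \<inter> M \<noteq> {}})" by auto
    have "branch_sum \<gamma> (length as) \<le> branch_sum \<gamma> (length (a # as))"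
      using \<beta> \<gamma> by (intro branch_sum_mono) auto
    then have "Q * real ?d * \<beta> ^ length Tr * \<gamma> ^ ?d * branch_sum \<gamma> (length as) \<le>
        Q * real ?d * \<beta> ^ length Tr * \<gamma> ^ ?d * branch_sum \<gamma> (length (a # as))"
      using \<beta> \<gamma> assms(3) by (intro mult_left_mono) auto
    moreover have "length (a # as) * (80 * z) = length as * (80 * z) + 80 * z"
      by (simp add: algebra_simps)
    ultimately have cost: "real k + k1 + 40 \<le> length (a # as) * (80 * z) + 3 +
        Q * real ?d * \<beta> ^ length Tr * \<gamma> ^ ?d * branch_sum \<gamma> (length (a # as))"
      using k(2) k1' z_bounds(1) by linarith
    have "\<exists>k'. call prog ENUM_BRANCH [syms (a # as), enc_prog rs, syms Tr, syms Fa, enc_atom_lists acc] =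
        Some (enc_atom_lists (Ms @ acc), k') \<and> real k' \<le> real k + k1 + 40"
      using k(1) k1(1) True by (subst call_prog) (simp add: enum_branch_body_def)
    then obtain k' where k': "call prog ENUM_BRANCH [syms (a # as), enc_prog rs, syms Tr, syms Fa,
        enc_atom_lists acc] = Some (enc_atom_lists (Ms @ acc), k')" "real k' \<le> real k + k1 + 40"
      by blast
    have "answer_sets_between Tr Fa \<inter> {M. set as \<inter> M \<noteq> {}} =
        answer_sets_between Tr Fa \<inter> {M. set (a # as) \<inter> M \<noteq> {}}" using True by auto
    then show ?thesis using k(3) order_trans[OF k'(2) cost] k'(1)
      by (intro exI[of _ Ms] exI[of _ k'] conjI) (simp_all only:)
  next
    case False
    have a: "a \<in> U - set Tr - set Fa" using Cons.prems(1) False by auto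
    have fin: "finite (U - set Tr - set Fa)" using U(1) by simp
    have d: "0 < ?d" using a fin card_gt_0_iff by blast
    have "U - set Tr - set (a # Fa) = (U - set Tr - set Fa) - {a}" by auto
    then have d': "card (U - set Tr - set (a # Fa)) = ?d - 1" using a fin by simp
    have "set as \<subseteq> U - set Tr" "distinct (a # Fa)" "set (a # Fa) \<subseteq> U - set Tr"
      "length (a # Fa) \<ge> fmin" using Cons.prems a by auto
    from Cons.IH[OF this, unfolded d'] obtain Ns k where
      k: "call prog ENUM_BRANCH [syms as, enc_prog rs, syms Tr, syms (a # Fa), enc_atom_lists acc] =
        Some (enc_atom_lists (Ns @ acc), k)"
      "real k \<le> length as * (80 * z) + 3 + Q * real (?d - 1) * \<beta> ^ length Tr * \<gamma> ^ (?d - 1) *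
        branch_sum \<gamma> (length as)"
      "enumerates Ns (answer_sets_between Tr (a # Fa) \<inter> {M. set as \<inter> M \<noteq> {}})"
      by (elim exE conjE) (rule that)
    from cand[OF a Cons.prems(2-4), of "Ns @ acc"] obtain Ms k' where
      k': "call prog ENUM [enc_prog rs, syms (a # Tr), syms Fa, enc_atom_lists (Ns @ acc)] =
          Some (enc_atom_lists (Ms @ Ns @ acc), k')"
      "real k' \<le> Q * real ?d * \<beta> ^ (length Tr + 1) * \<gamma> ^ (?d - 1)"
      "enumerates Ms (answer_sets_between (a # Tr) Fa)" by (elim exE conjE) (rule that)
    have "answer_sets_between (a # Tr) Fa \<inter>
        (answer_sets_between Tr (a # Fa) \<inter> {M. set as \<inter> M \<noteq> {}}) = {}" by auto
    moreover have "answer_sets_between (a # Tr) Fa \<union>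
        (answer_sets_between Tr (a # Fa) \<inter> {M. set as \<inter> M \<noteq> {}}) =
        answer_sets_between Tr Fa \<inter> {M. set (a # as) \<inter> M \<noteq> {}}" by auto
    ultimately have en: "enumerates (Ms @ Ns) (answer_sets_between Tr Fa \<inter> {M. set (a # as) \<inter> M \<noteq> {}})"
      using enumerates_append[OF k'(3) k(3)] by simp
    have "\<exists>k''. call prog ENUM_BRANCH [syms (a # as), enc_prog rs, syms Tr, syms Fa, enc_atom_lists acc] =
        Some (enc_atom_lists ((Ms @ Ns) @ acc), k'') \<and> real k'' \<le> real k + k1 + k' + 60"
      using k(1) k1(1) k'(1) False by (subst call_prog) (simp add: enum_branch_body_def)
    then obtain k'' where k'': "call prog ENUM_BRANCH [syms (a # as), enc_prog rs, syms Tr, syms Fa,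
        enc_atom_lists acc] = Some (enc_atom_lists ((Ms @ Ns) @ acc), k'')"
      "real k'' \<le> real k + k1 + k' + 60" by blast
    have "real k + k1 + k' + 60 \<le> length (a # as) * (80 * z) + 3 +
        Q * real ?d * \<beta> ^ length Tr * \<gamma> ^ ?d * branch_sum \<gamma> (length (a # as))"
    proof -
      have "Q * real (?d - 1) * \<beta> ^ length Tr * \<gamma> ^ (?d - 1) * branch_sum \<gamma> (length as) \<le>
          Q * real ?d * \<beta> ^ length Tr * \<gamma> ^ (?d - 1) * branch_sum \<gamma> (length as)"
        using \<beta> \<gamma> assms(3) branch_sum_mono[of \<gamma> 0 "length as"]
        by (intro mult_right_mono mult_left_mono) (auto simp: branch_sum_0)
      moreover have "Q * real ?d * \<beta> ^ (length Tr + 1) * \<gamma> ^ (?d - 1) +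
          Q * real ?d * \<beta> ^ length Tr * \<gamma> ^ (?d - 1) * branch_sum \<gamma> (length as) =
          Q * real ?d * \<beta> ^ length Tr * \<gamma> ^ ?d * branch_sum \<gamma> (length (a # as))"
      proof -
        have "\<gamma> ^ ?d = \<gamma> ^ (?d - 1) * \<gamma>" using d by (metis Suc_pred' power_Suc2)
        then show ?thesis using \<gamma> by (simp add: branch_sum_Suc field_simps)
      qed
      moreover have "length (a # as) * (80 * z) = length as * (80 * z) + 80 * z"
        by (simp add: algebra_simps)
      ultimately show ?thesis using k(2) k'(2) k1' z_bounds(1) by linarith
    qed
    from order_trans[OF k''(2) this] k''(1) en show ?thesis by blast
  qed
qed

end

section \<open>The budget of the whole branching tree\<close>

lemma finite_prog_atoms: "finite (prog_atoms (set rs))"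
  by (simp add: prog_atoms_def rule_atoms_def)

lemma prog_atoms_subset:
  "r \<in> set rs \<Longrightarrow> set (head r) \<union> set (neg_body r) \<subseteq> prog_atoms (set rs)"
  by (auto simp: prog_atoms_def rule_atoms_def)

context bounded_code
begin

lemma branch_sum_closed_form:
  "\<gamma> \<noteq> 0 \<Longrightarrow> \<gamma> \<noteq> 1 \<Longrightarrow> branch_sum \<gamma> j = \<beta> * (1 - 1 / \<gamma> ^ j) / (\<gamma> - 1)"
proof (induction j)
  case (Suc j)
  then have IH: "branch_sum \<gamma> j = \<beta> * (1 - 1 / \<gamma> ^ j) / (\<gamma> - 1)" by simp
  have "branch_sum \<gamma> (Suc j) = \<beta> / \<gamma> * (1 + (1 - 1 / \<gamma> ^ j) / (\<gamma> - 1))"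
    unfolding branch_sum_Suc IH using Suc.prems by (simp add: distrib_left)
  also have "1 + (1 - 1 / \<gamma> ^ j) / (\<gamma> - 1) = \<gamma> * (1 - 1 / \<gamma> ^ Suc j) / (\<gamma> - 1)"
    using Suc.prems by (simp add: field_simps)
  finally show ?case using Suc.prems by simp
qed (simp add: branch_sum_0)

text \<open>The violation test, and the minimality test at a leaf with its factor
  \<open>\<beta> ^ length Tr\<close> taken out; \<open>\<beta> ^ b\<close> stems from
  \<open>blocks_cost\<close>.\<close>

definition node_cost :: real where
  "node_cost = step_cost + z * (search_cost * z * \<beta> ^ b + 100 * z) + 100"

text \<open>With \<open>d\<close> undecided atoms at a node, its children have at most
  \<open>d - 1\<close>, so they are charged with the factor \<open>d\<close> and together use at
  most the fraction \<open>branch_sum \<gamma> t \<le> 1\<close> of the budget. The remaining unit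
  of \<open>d + 1\<close> pays for the node itself.\<close>

lemma call_enum:
  assumes \<beta>: "0 \<le> \<beta>" and \<gamma>: "1 \<le> \<gamma>" and sum_le: "branch_sum \<gamma> t \<le> 1"
  defines "U \<equiv> prog_atoms (set rs)"
  assumes U: "card U \<le> s"
  shows "\<lbrakk>distinct Tr; set Tr \<subseteq> U; distinct Fa; set Fa \<subseteq> U - set Tr\<rbrakk> \<Longrightarrow>
    \<exists>Ms k. call prog ENUM [enc_prog rs, syms Tr, syms Fa, enc_atom_lists acc] =
        Some (enc_atom_lists (Ms @ acc), k) \<and>
      real k \<le> node_cost * (real (card (U - set Tr - set Fa)) + 1) * \<beta> ^ length Tr *
        \<gamma> ^ card (U - set Tr - set Fa) \<and>
      enumerates Ms (answer_sets_between Tr Fa)"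
proof (induction "card (U - set Tr - set Fa)" arbitrary: Tr Fa acc rule: less_induct)
  case less
  define d where "d = card (U - set Tr - set Fa)"
  have finU: "finite U" unfolding U_def by (rule finite_prog_atoms)
  have lTr: "length Tr \<le> s"
    using less.prems(1,2) U finU by (metis card_mono distinct_card order_trans)
  have b1: "1 \<le> \<beta>" using \<beta> by (rule beta_ge_1)
  have bt: "1 \<le> \<beta> ^ length Tr" using b1 by (rule one_le_power)
  have gd: "1 \<le> \<gamma> ^ d" using \<gamma> by (rule one_le_power)
  have X1: "1 \<le> \<beta> ^ length Tr * \<gamma> ^ d" using mult_mono[OF bt gd] bt by simp
  define Y where "Y = z * (search_cost * z * \<beta> ^ b + 100 * z)"
  have "0 \<le> Y" using \<beta> z_bounds(1) search_cost_bounds(1) by (simp add: Y_def)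
  then have nc: "step_cost + 100 \<le> node_cost" "0 \<le> node_cost"
    using step_cost_nonneg by (simp_all add: node_cost_def Y_def)
  obtain k where k: "call prog VIOLATED [enc_prog rs, syms Tr, syms Tr] =
      Some (case find (\<lambda>r. violates r (set Tr) (set Tr)) rs of None \<Rightarrow> SNil | Some r \<Rightarrow> enc_rule r, k)"
    "real k \<le> 160 * z^3" using call_violated_cube[OF lTr lTr] by blast
  show ?case
  proof (cases "find (\<lambda>r. violates r (set Tr) (set Tr)) rs")
    case None
    then have unv: "unviolated rs (set Tr) (set Tr)" by (auto simp: find_None_iff unviolated_def)
    obtain v k1 where k1: "call prog MINIMAL [syms Tr, syms Tr, enc_prog rs] = Some (v, k1)"
      "real k1 \<le> length Tr * (search_cost * z * \<beta> ^ (length Tr + b) + 100 * z) + 5"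
      "v \<noteq> SNil \<longleftrightarrow> (\<forall>a\<in>set Tr. \<not> (\<exists>N\<subseteq>set Tr - {a}. unviolated rs (set Tr) N))"
      using call_minimal[OF less.prems(1) lTr \<beta> order_refl] by (elim exE conjE) (rule that)
    have v: "v \<noteq> SNil \<longleftrightarrow> answer_set (set rs) (set Tr)"
      using k1(3) unv by (simp add: answer_set_iff_delete_atom)
    define Ms where "Ms = (if v \<noteq> SNil then [Tr] else [])"
    have "answer_sets_between Tr Fa = (if v \<noteq> SNil then {set Tr} else {})"
      using answer_set_eq_if_unviolated[OF _ unv] v less.prems(4) by auto
    then have en: "enumerates Ms (answer_sets_between Tr Fa)"
      using less.prems(1) by (auto simp: Ms_def enumerates_def)
    have "\<exists>k'. call prog ENUM [enc_prog rs, syms Tr, syms Fa, enc_atom_lists acc] =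
        Some (enc_atom_lists (Ms @ acc), k') \<and> real k' \<le> real k + k1 + 60"
      using k(1) k1(1) None
      by (subst call_prog)
        (simp add: enum_body_def call_prog(16) enum_at_body_def Ms_def enc_atom_lists_simps)
    then obtain k' where k': "call prog ENUM [enc_prog rs, syms Tr, syms Fa, enc_atom_lists acc] =
        Some (enc_atom_lists (Ms @ acc), k')" "real k' \<le> real k + k1 + 60" by blast
    have "length Tr * (search_cost * z * \<beta> ^ (length Tr + b) + 100 * z) \<le>
        z * (search_cost * z * \<beta> ^ (length Tr + b) + 100 * z)"
      using lTr \<beta> z_bounds(1) search_cost_bounds(1) by (intro mult_right_mono) (auto simp: z_def)
    also have "\<dots> \<le> z * (search_cost * z * \<beta> ^ b * \<beta> ^ length Tr + 100 * z * \<beta> ^ length Tr)"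
    proof -
      have "100 * z * 1 \<le> 100 * z * \<beta> ^ length Tr" using bt z_bounds(1) by (intro mult_left_mono) auto
      then show ?thesis using z_bounds(1) by (intro mult_left_mono) (auto simp: power_add mult_ac)
    qed
    also have "\<dots> = Y * \<beta> ^ length Tr" by (simp add: Y_def algebra_simps)
    finally have "real k1 \<le> Y * \<beta> ^ length Tr + 5" using k1(2) by simp
    then have "real k' \<le> (step_cost + 100) * 1 + Y * \<beta> ^ length Tr"
      using k'(2) k(2) z_bounds(5) unfolding step_cost_def by simp
    also have "\<dots> \<le> (step_cost + 100) * \<beta> ^ length Tr + Y * \<beta> ^ length Tr"
      using bt step_cost_nonneg by (intro add_right_mono mult_left_mono) auto
    also have "\<dots> = node_cost * 1 * \<beta> ^ length Tr * 1" by (simp add: node_cost_def Y_def algebra_simps)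
    also have "\<dots> \<le> node_cost * (real d + 1) * \<beta> ^ length Tr * \<gamma> ^ d"
      using nc(2) \<beta> gd by (intro mult_mono) auto
    finally show ?thesis using k'(1) en unfolding d_def by blast
  next
    case (Some q)
    obtain hs ps ns where q: "q = Rule hs ps ns" by (cases q)
    have qv: "q \<in> set rs" "violates q (set Tr) (set Tr)"
      using Some by (auto simp: find_Some_iff in_set_conv_nth)
    have as: "set (hs @ ns) \<subseteq> U - set Tr"
      using prog_atoms_subset[OF qv(1)] qv(2) by (auto simp: U_def q violates_def)
    have las: "length (hs @ ns) \<le> t" "length (hs @ ns) \<le> s" "length hs \<le> s"
      using rule_length_le_t[OF qv(1)] rule_length_le_s[OF qv(1)] by (auto simp: q rule_length_def)
    have child: "\<exists>Ms k. call prog ENUM [enc_prog rs, syms (a # Tr), syms Fa', enc_atom_lists acc'] =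
          Some (enc_atom_lists (Ms @ acc'), k) \<and>
        real k \<le> node_cost * real (card (U - set Tr - set Fa')) * \<beta> ^ (length Tr + 1) *
          \<gamma> ^ (card (U - set Tr - set Fa') - 1) \<and>
        enumerates Ms (answer_sets_between (a # Tr) Fa')"
      if a: "a \<in> U - set Tr - set Fa'" and Fa': "distinct Fa'" "set Fa' \<subseteq> U - set Tr"
        "length Fa \<le> length Fa'" for a Fa' acc'
    proof -
      have card: "card (U - set Tr - set F) = card (U - set Tr) - length F"
        if "distinct F" "set F \<subseteq> U - set Tr" for F
        using that finU by (simp add: card_Diff_subset distinct_card)
      have "U - set (a # Tr) - set Fa' = (U - set Tr - set Fa') - {a}" by auto
      then have c: "card (U - set (a # Tr) - set Fa') = card (U - set Tr - set Fa') - 1"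
        using a finU by simp
      have pos: "0 < card (U - set Tr - set Fa')" using a finU card_gt_0_iff by blast
      have "card (U - set Tr - set Fa') \<le> card (U - set Tr - set Fa)"
        using card[OF Fa'(1,2)] card[OF less.prems(3,4)] Fa'(3) by simp
      then have "card (U - set (a # Tr) - set Fa') < card (U - set Tr - set Fa)"
        using c pos by linarith
      moreover have "distinct (a # Tr)" "set (a # Tr) \<subseteq> U" "set Fa' \<subseteq> U - set (a # Tr)"
        using a less.prems(1,2) Fa'(2) by auto
      ultimately have "\<exists>Ms k. call prog ENUM [enc_prog rs, syms (a # Tr), syms Fa', enc_atom_lists acc'] =
          Some (enc_atom_lists (Ms @ acc'), k) \<and>
        real k \<le> node_cost * (real (card (U - set (a # Tr) - set Fa')) + 1) * \<beta> ^ length (a # Tr) *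
          \<gamma> ^ card (U - set (a # Tr) - set Fa') \<and>
        enumerates Ms (answer_sets_between (a # Tr) Fa')" using Fa'(1) by (intro less.hyps)
      moreover have "real (card (U - set (a # Tr) - set Fa')) + 1 = real (card (U - set Tr - set Fa'))"
        using c pos by simp
      ultimately show ?thesis unfolding c by simp
    qed
    have "\<exists>Ms k1. call prog ENUM_BRANCH [syms (hs @ ns), enc_prog rs, syms Tr, syms Fa,
          enc_atom_lists acc] = Some (enc_atom_lists (Ms @ acc), k1) \<and>
      real k1 \<le> length (hs @ ns) * (80 * z) + 3 + node_cost * real d * \<beta> ^ length Tr *
        \<gamma> ^ d * branch_sum \<gamma> (length (hs @ ns)) \<and>
      enumerates Ms (answer_sets_between Tr Fa \<inter> {M. set (hs @ ns) \<inter> M \<noteq> {}})"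
      unfolding d_def
      by (rule call_enum_branch[where fmin = "length Fa", OF \<beta> \<gamma> nc(2) finU U less.prems(1,2) _ as
          less.prems(3,4) order_refl]) (rule child)
    then obtain Ms k1 where k1: "call prog ENUM_BRANCH [syms (hs @ ns), enc_prog rs, syms Tr, syms Fa,
          enc_atom_lists acc] = Some (enc_atom_lists (Ms @ acc), k1)"
      "real k1 \<le> length (hs @ ns) * (80 * z) + 3 + node_cost * real d * \<beta> ^ length Tr *
        \<gamma> ^ d * branch_sum \<gamma> (length (hs @ ns))"
      "enumerates Ms (answer_sets_between Tr Fa \<inter> {M. set (hs @ ns) \<inter> M \<noteq> {}})"
      by (elim exE conjE) (rule that)
    \<comment> \<open>The positive body of \<open>q\<close> lies in \<open>Tr\<close>, hence in
      \<open>M\<close>. As \<open>M\<close> does not violate \<open>q\<close>, it meets the head or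
      the negated body, so the branches miss no answer set.\<close>
    have "set (hs @ ns) \<inter> M \<noteq> {}" if M: "answer_set (set rs) M" "set Tr \<subseteq> M" for M
    proof -
      have "\<not> violates q M M" using M(1) qv(1) by (auto simp: answer_set_iff unviolated_def)
      then show ?thesis using qv(2) M(2) by (auto simp: violates_def q)
    qed
    then have "answer_sets_between Tr Fa \<inter> {M. set (hs @ ns) \<inter> M \<noteq> {}} = answer_sets_between Tr Fa"
      by blast
    then have en: "enumerates Ms (answer_sets_between Tr Fa)" using k1(3) by simp
    obtain k2 where k2: "call prog APPEND [syms hs, syms ns] = Some (syms (hs @ ns), k2)"
      "k2 \<le> 20 * (length hs + 1)" using call_append by blast
    have "\<exists>k'. call prog ENUM [enc_prog rs, syms Tr, syms Fa, enc_atom_lists acc] =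
        Some (enc_atom_lists (Ms @ acc), k') \<and> real k' \<le> real k + k1 + k2 + 60"
      using k(1) k1(1) k2(1) Some q
      by (subst call_prog) (simp add: enum_body_def call_prog(16) enum_at_body_def)
    then obtain k' where k': "call prog ENUM [enc_prog rs, syms Tr, syms Fa, enc_atom_lists acc] =
        Some (enc_atom_lists (Ms @ acc), k')" "real k' \<le> real k + k1 + k2 + 60" by blast
    have "real k2 \<le> 20 * z" using linear_cost[OF k2(2) las(3)] .
    moreover have "length (hs @ ns) * (80 * z) \<le> z * (80 * z)"
      using las(2) z_bounds(1) by (intro mult_right_mono) (auto simp: z_def)
    then have "length (hs @ ns) * (80 * z) \<le> 80 * z^2" by (simp add: power2_eq_square)
    moreover have "node_cost * real d * \<beta> ^ length Tr * \<gamma> ^ d * branch_sum \<gamma> (length (hs @ ns)) \<le>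
        node_cost * real d * \<beta> ^ length Tr * \<gamma> ^ d * 1"
      using branch_sum_mono[OF \<beta> _ las(1), of \<gamma>] \<gamma> sum_le nc(2) \<beta> by (intro mult_left_mono) auto
    ultimately have "real k1 \<le> 80 * z^2 + 3 + node_cost * real d * \<beta> ^ length Tr * \<gamma> ^ d * 1"
      using k1(2) by linarith
    moreover have "node_cost * real d * \<beta> ^ length Tr * \<gamma> ^ d * 1 =
        node_cost * real d * (\<beta> ^ length Tr * \<gamma> ^ d)" by simp
    ultimately have "real k' \<le> node_cost * 1 + node_cost * real d * (\<beta> ^ length Tr * \<gamma> ^ d)"
      using k'(2) k(2) nc(1) z_bounds \<open>real k2 \<le> 20 * z\<close> unfolding step_cost_def by linarith
    also have "\<dots> \<le> node_cost * (\<beta> ^ length Tr * \<gamma> ^ d) + node_cost * real d * (\<beta> ^ length Tr * \<gamma> ^ d)"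
      using X1 nc(2) by (intro add_right_mono mult_left_mono) auto
    also have "\<dots> = node_cost * (real d + 1) * \<beta> ^ length Tr * \<gamma> ^ d" by (simp add: algebra_simps)
    finally show ?thesis using k'(1) en unfolding d_def by blast
  qed
qed

lemma call_enum_initial:
  assumes "0 \<le> \<beta>" "1 \<le> \<gamma>" "branch_sum \<gamma> t \<le> 1" "card (prog_atoms (set rs)) \<le> s"
  shows "\<exists>Ms k. call prog ENUM [enc_prog rs, SNil, SNil, SNil] = Some (enc_atom_lists Ms, k) \<and>
    real k \<le> node_cost * z * \<gamma> ^ card (prog_atoms (set rs)) \<and>
    enumerates Ms {M. answer_set (set rs) M}"
proof -
  obtain Ms k where k: "call prog ENUM [enc_prog rs, SNil, SNil, SNil] = Some (enc_atom_lists Ms, k)"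
    "real k \<le> node_cost * (real (card (prog_atoms (set rs))) + 1) * \<gamma> ^ card (prog_atoms (set rs))"
    "enumerates Ms {M. answer_set (set rs) M}"
    using call_enum[OF assms, of "[]" "[]" "[]"] by (auto simp: enc_atom_lists_simps)
  have "0 \<le> node_cost"
    using assms(1) z_bounds(1) search_cost_bounds(1) step_cost_nonneg by (simp add: node_cost_def)
  then have "node_cost * (real (card (prog_atoms (set rs))) + 1) * \<gamma> ^ card (prog_atoms (set rs)) \<le>
      node_cost * z * \<gamma> ^ card (prog_atoms (set rs))"
    using assms(2,4) by (intro mult_right_mono mult_left_mono) (auto simp: z_def)
  then show ?thesis using k by (meson order_trans)
qed

end

section \<open>Clauses as rules\<close>

text \<open>Negative literals become positive body atoms. The accumulators reproduce the list order
  of the function \<open>CLAUSE\<close>.\<close>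

fun clause_rule :: "clause \<Rightarrow> atom list \<Rightarrow> atom list \<Rightarrow> rule" where
  "clause_rule [] ps ns = Rule ps ns []"
| "clause_rule (Pos a # c) ps ns = clause_rule c (a # ps) ns"
| "clause_rule (Neg a # c) ps ns = clause_rule c ps (a # ns)"

lemma clause_rule_sets:
  "set (head (clause_rule c ps ns)) = set ps \<union> {a. Pos a \<in> set c}"
  "set (pos_body (clause_rule c ps ns)) = set ns \<union> {a. Neg a \<in> set c}"
  "neg_body (clause_rule c ps ns) = []"
  "rule_length (clause_rule c ps ns) = length c + length ps + length ns"
  by (induction c ps ns rule: clause_rule.induct) (auto simp: rule_length_def)

text \<open>\<open>M\<close> drops out because the negated body is empty: the reduct of such a
  program is the program itself.\<close>

lemma violates_clause_rule:
  "violates (clause_rule c [] []) N M \<longleftrightarrow> \<not> (\<exists>l\<in>set c. sat_literal N l)"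
proof
  assume v: "violates (clause_rule c [] []) N M"
  show "\<not> (\<exists>l\<in>set c. sat_literal N l)"
  proof
    assume "\<exists>l\<in>set c. sat_literal N l"
    then obtain l where "l \<in> set c" "sat_literal N l" by blast
    then show False using v by - (cases l; auto simp: violates_def clause_rule_sets)
  qed
next
  assume "\<not> (\<exists>l\<in>set c. sat_literal N l)"
  then show "violates (clause_rule c [] []) N M"
    by (force simp: violates_def clause_rule_sets)
qed

abbreviation cnf_rules :: "clause list \<Rightarrow> rule list" where
  "cnf_rules xs \<equiv> map (\<lambda>c. clause_rule c [] []) xs"

lemma answer_set_cnf_rules:
  "answer_set (set (cnf_rules xs)) M \<longleftrightarrow> minimal_model (cnf_model (set xs)) M"
proof -
  have "unviolated (cnf_rules xs) M N \<longleftrightarrow> cnf_model (set xs) N" for M N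
    by (auto simp: unviolated_def cnf_model_def violates_clause_rule)
  then show ?thesis unfolding answer_set_iff minimal_model_def by blast
qed

lemma prog_atoms_cnf_rules: "prog_atoms (set (cnf_rules xs)) = cnf_atoms (set xs)"
proof -
  have "rule_atoms (clause_rule c [] []) = atom_of ` set c" for c
    by (auto simp: rule_atoms_def clause_rule_sets image_iff) (metis literal.exhaust literal.sel)+
  then show ?thesis by (simp add: prog_atoms_def cnf_atoms_def)
qed

context answer_set_program
begin

lemma call_clause:
  "\<exists>k. call prog CLAUSE [enc_list enc_literal c, syms ps, syms ns] =
     Some (enc_rule (clause_rule c ps ns), k) \<and> k \<le> 40 * (length c + 1)"
proof (induction c ps ns rule: clause_rule.induct)
  case (1 ps ns)
  show ?case by (subst call_prog) (simp add: clause_body_def)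
next
  case (2 a c ps ns)
  then obtain k where "call prog CLAUSE [enc_list enc_literal c, syms (a # ps), syms ns] =
     Some (enc_rule (clause_rule c (a # ps) ns), k)" "k \<le> 40 * (length c + 1)" by blast
  then show ?case by (subst call_prog) (simp add: clause_body_def)
next
  case (3 a c ps ns)
  then obtain k where "call prog CLAUSE [enc_list enc_literal c, syms ps, syms (a # ns)] =
     Some (enc_rule (clause_rule c ps (a # ns)), k)" "k \<le> 40 * (length c + 1)" by blast
  then show ?case by (subst call_prog) (simp add: clause_body_def)
qed

lemma call_clauses:
  "\<exists>k. call prog CLAUSES [enc_cnf xs] = Some (enc_prog (cnf_rules xs), k) \<and>
     k \<le> 60 * (sum_list (map length xs) + 2 * length xs) + 5"
proof (induction xs)
  case Nil
  show ?case by (subst call_prog) (simp add: clauses_body_def enc_cnf_def enc_prog_def)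
next
  case (Cons c xs)
  then obtain k where "call prog CLAUSES [enc_cnf xs] = Some (enc_prog (cnf_rules xs), k)"
    "k \<le> 60 * (sum_list (map length xs) + 2 * length xs) + 5" by blast
  moreover obtain k' where "call prog CLAUSE [enc_list enc_literal c, SNil, SNil] =
     Some (enc_rule (clause_rule c [] []), k')" "k' \<le> 40 * (length c + 1)"
    using call_clause[of c "[]" "[]"] by auto
  ultimately show ?case by (subst call_prog) (simp add: clauses_body_def enc_cnf_def enc_prog_def)
qed

end

section \<open>Covering codes\<close>

text \<open>Symmetric difference with \<open>c\<close> is an involution that moves the sphere around
  \<open>c\<close> to the sets of size \<open>\<rho>\<close>.\<close>

lemma card_sym_diff_sphere:
  assumes "c \<subseteq> {..<b::nat}"
  shows "card {w. w \<subseteq> {..<b} \<and> card (sym_diff c w) = \<rho>} = b choose \<rho>"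
proof -
  have "bij_betw (\<lambda>d. sym_diff c d) {d. d \<subseteq> {..<b} \<and> card d = \<rho>}
      {w. w \<subseteq> {..<b} \<and> card (sym_diff c w) = \<rho>}"
  proof (rule bij_betw_byWitness[where f' = "\<lambda>d. sym_diff c d"])
    have 1: "sym_diff c (sym_diff c d) = d" for d by auto
    show "\<forall>d\<in>{d. d \<subseteq> {..<b} \<and> card d = \<rho>}. sym_diff c (sym_diff c d) = d"
      "\<forall>d\<in>{w. w \<subseteq> {..<b} \<and> card (sym_diff c w) = \<rho>}. sym_diff c (sym_diff c d) = d"
      using 1 by blast+
    show "(\<lambda>d. sym_diff c d) ` {d. d \<subseteq> {..<b} \<and> card d = \<rho>} \<subseteq>
        {w. w \<subseteq> {..<b} \<and> card (sym_diff c w) = \<rho>}"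
      using assms unfolding image_subset_iff mem_Collect_eq 1 by blast
    show "(\<lambda>d. sym_diff c d) ` {w. w \<subseteq> {..<b} \<and> card (sym_diff c w) = \<rho>} \<subseteq>
        {d. d \<subseteq> {..<b} \<and> card d = \<rho>}"
      using assms unfolding image_subset_iff mem_Collect_eq by blast
  qed
  then have "card {w. w \<subseteq> {..<b} \<and> card (sym_diff c w) = \<rho>} =
      card {d. d \<subseteq> {..<b} \<and> card d = \<rho>}" by (simp add: bij_betw_same_card)
  also have "\<dots> = b choose \<rho>" using n_subsets[of "{..<b}" \<rho>] by simp
  finally show ?thesis .
qed

text \<open>Double counting: on average over all centres, a sphere contains the fraction
  \<open>(b choose \<rho>) / 2 ^ b\<close> of the words that are still uncovered.\<close>

lemma exists_good_centre:
  assumes "U \<subseteq> Pow {..<b::nat}"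
  shows "\<exists>c\<subseteq>{..<b}. real (card U) * real (b choose \<rho>) / 2 ^ b \<le>
    real (card {w\<in>U. card (sym_diff c w) = \<rho>})"
proof (rule ccontr)
  assume "\<not> ?thesis"
  then have less: "real (card {w\<in>U. card (sym_diff c w) = \<rho>}) < real (card U) * real (b choose \<rho>) / 2 ^ b"
    if "c \<in> Pow {..<b}" for c using that by (auto simp: not_le)
  have fU: "finite U" using assms finite_subset by blast
  have "real (card U) * real (b choose \<rho>) = (\<Sum>w\<in>U. real (card {c\<in>Pow {..<b}. card (sym_diff c w) = \<rho>}))"
  proof -
    have "card {c\<in>Pow {..<b}. card (sym_diff c w) = \<rho>} = b choose \<rho>" if "w \<in> U" for w
    proof -
      have "{c\<in>Pow {..<b}. card (sym_diff c w) = \<rho>} = {c. c \<subseteq> {..<b} \<and> card (sym_diff w c) = \<rho>}"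
        by (simp add: Un_commute)
      then show ?thesis using card_sym_diff_sphere[of w b \<rho>] that assms by auto
    qed
    then show ?thesis by simp
  qed
  also have "\<dots> = (\<Sum>w\<in>U. \<Sum>c\<in>Pow {..<b}. if card (sym_diff c w) = \<rho> then 1 else 0)"
    by (simp add: sum.If_cases Int_def conj_commute)
  also have "\<dots> = (\<Sum>c\<in>Pow {..<b}. \<Sum>w\<in>U. if card (sym_diff c w) = \<rho> then 1 else 0)"
    by (rule sum.swap)
  also have "\<dots> = (\<Sum>c\<in>Pow {..<b}. real (card {w\<in>U. card (sym_diff c w) = \<rho>}))"
    using fU by (simp add: sum.If_cases Int_def conj_commute)
  also have "\<dots> < (\<Sum>c\<in>Pow {..<b}. real (card U) * real (b choose \<rho>) / 2 ^ b)"
    by (rule sum_strict_mono) (use less in auto)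
  also have "\<dots> = real (card U) * real (b choose \<rho>)" by (simp add: card_Pow)
  finally show False by simp
qed

text \<open>Adding a good centre for the uncovered words multiplies their number by at most
  \<open>1 - (b choose \<rho>) / 2 ^ b\<close>. Spheres are counted instead of balls, which keeps
  this factor a single binomial coefficient.\<close>

lemma greedy_covering:
  fixes b \<rho> :: nat
  shows "\<exists>cs. length cs = k \<and> (\<forall>c\<in>set cs. c \<subseteq> {..<b}) \<and>
    real (card {w\<in>Pow {..<b}. \<forall>c\<in>set cs. card (sym_diff c w) \<noteq> \<rho>}) \<le>
      2 ^ b * (1 - real (b choose \<rho>) / 2 ^ b) ^ k"
proof (induction k)
  case 0
  show ?case by (simp add: card_Pow flip: Pow_def)
next
  case (Suc k)
  then obtain cs where cs: "length cs = k" "\<forall>c\<in>set cs. c \<subseteq> {..<b}" and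
    le: "real (card {w\<in>Pow {..<b}. \<forall>c\<in>set cs. card (sym_diff c w) \<noteq> \<rho>}) \<le>
      2 ^ b * (1 - real (b choose \<rho>) / 2 ^ b) ^ k" by blast
  define U where "U = {w\<in>Pow {..<b}. \<forall>c\<in>set cs. card (sym_diff c w) \<noteq> \<rho>}"
  obtain c where c: "c \<subseteq> {..<b}"
    "real (card U) * real (b choose \<rho>) / 2 ^ b \<le> real (card {w\<in>U. card (sym_diff c w) = \<rho>})"
    using exists_good_centre[of U b \<rho>] by (auto simp: U_def)
  have fU: "finite U" by (simp add: U_def)
  have "{w\<in>Pow {..<b}. \<forall>c\<in>set (c # cs). card (sym_diff c w) \<noteq> \<rho>} =
      U - {w\<in>U. card (sym_diff c w) = \<rho>}" by (auto simp: U_def)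
  then have "real (card {w\<in>Pow {..<b}. \<forall>c\<in>set (c # cs). card (sym_diff c w) \<noteq> \<rho>}) =
      real (card U) - real (card {w\<in>U. card (sym_diff c w) = \<rho>})"
    using fU by (simp add: card_Diff_subset of_nat_diff card_mono)
  also have "\<dots> \<le> real (card U) * (1 - real (b choose \<rho>) / 2 ^ b)"
    using c(2) by (simp add: algebra_simps)
  also have "\<dots> \<le> 2 ^ b * (1 - real (b choose \<rho>) / 2 ^ b) ^ k * (1 - real (b choose \<rho>) / 2 ^ b)"
  proof (rule mult_right_mono)
    show "real (card U) \<le> 2 ^ b * (1 - real (b choose \<rho>) / 2 ^ b) ^ k" using le by (simp add: U_def)
    have "b choose \<rho> \<le> 2 ^ b" by (rule binomial_le_pow2)
    then have "real (b choose \<rho>) \<le> real (2 ^ b)" by (simp only: of_nat_le_iff)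
    then show "0 \<le> 1 - real (b choose \<rho>) / 2 ^ b" by simp
  qed
  finally show ?case using cs c(1)
    by (intro exI[of _ "c # cs"]) (simp add: mult_ac)
qed

text \<open>After \<open>b * 2^b / V\<close> greedy steps, with \<open>V\<close> the size of a
  sphere, at most \<open>2^b * exp (-b) < 1\<close> words are uncovered, and thus none. The step
  added by rounding up is absorbed by \<open>b + 1\<close>.\<close>

lemma covering_code_size:
  assumes "0 < b" "\<rho> \<le> b"
  shows "\<exists>cs. (\<forall>c\<in>set cs. c \<subseteq> {..<b}) \<and> (\<forall>w\<subseteq>{..<b}. \<exists>c\<in>set cs. card (sym_diff c w) \<le> \<rho>) \<and>
    real (length cs) \<le> (real b + 1) * 2 ^ b / real (b choose \<rho>)"
proof -
  define V where "V = real (b choose \<rho>)"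
  have "b choose \<rho> \<le> 2 ^ b" by (rule binomial_le_pow2)
  then have "real (b choose \<rho>) \<le> real (2 ^ b)" by (simp only: of_nat_le_iff)
  then have V: "0 < V" "V \<le> 2 ^ b" using assms(2) by (auto simp: V_def)
  define k where "k = nat \<lceil>real b * 2 ^ b / V\<rceil>"
  have "0 \<le> real b * 2 ^ b / V" using V by simp
  then have k: "real b * 2 ^ b / V \<le> real k" "real k \<le> real b * 2 ^ b / V + 1"
    unfolding k_def by linarith+
  obtain cs where cs: "length cs = k" "\<forall>c\<in>set cs. c \<subseteq> {..<b}" and
    le: "real (card {w\<in>Pow {..<b}. \<forall>c\<in>set cs. card (sym_diff c w) \<noteq> \<rho>}) \<le>
      2 ^ b * (1 - V / 2 ^ b) ^ k" using greedy_covering[of k b \<rho>] unfolding V_def by blast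
  have "(1 - V / 2 ^ b) ^ k \<le> exp (- (V / 2 ^ b)) ^ k"
    using V exp_ge_add_one_self[of "- (V / 2 ^ b)"] by (intro power_mono) (auto simp: field_simps)
  also have "\<dots> = exp (- (real k * V / 2 ^ b))" by (simp flip: exp_of_nat_mult)
  also have "\<dots> \<le> exp (- real b)"
    using k(1) V by (simp add: field_simps)
  finally have "2 ^ b * (1 - V / 2 ^ b) ^ k \<le> 2 ^ b * exp (- real b)" by simp
  also have "\<dots> = (2 * exp (- 1)) ^ b"
    by (simp add: power_mult_distrib flip: exp_of_nat_mult)
  also have "\<dots> < 1"
  proof -
    have "2 * exp (- 1 :: real) < 1"
    proof -
      have "exp (ln 2 :: real) < exp 1" using ln_2_less_1 by (simp only: exp_less_cancel_iff)
      then show ?thesis by (simp add: exp_minus field_simps)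
    qed
    moreover have "0 \<le> 2 * exp (- 1 :: real)" by simp
    ultimately show ?thesis using assms(1) power_less_one_iff by blast
  qed
  finally have "card {w\<in>Pow {..<b}. \<forall>c\<in>set cs. card (sym_diff c w) \<noteq> \<rho>} = 0" using le by linarith
  then have "{w\<in>Pow {..<b}. \<forall>c\<in>set cs. card (sym_diff c w) \<noteq> \<rho>} = {}" by simp
  then have "\<exists>c\<in>set cs. card (sym_diff c w) = \<rho>" if "w \<subseteq> {..<b}" for w
    using that by blast
  then have cov: "\<forall>w\<subseteq>{..<b}. \<exists>c\<in>set cs. card (sym_diff c w) \<le> \<rho>"
    by (metis order_refl)
  have "1 \<le> 2 ^ b / V" using V by simp
  then have "real k \<le> (real b + 1) * 2 ^ b / V" using k(2) by (simp add: algebra_simps add_divide_distrib)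
  then show ?thesis using cs cov unfolding V_def by blast
qed

text \<open>The summands of the expansion of \<open>(1 + t) ^ b\<close> rise up to
  \<open>k = b / (t + 1)\<close> and fall afterwards, so the one at \<open>\<rho>\<close> is at
  least the average of all \<open>b + 1\<close>.\<close>

lemma binomial_central_term:
  fixes t \<rho> :: nat
  assumes "0 < t"
  defines "b \<equiv> (t + 1) * \<rho>"
  shows "real (t + 1) ^ b \<le> (real b + 1) * (real (b choose \<rho>) * real t ^ (b - \<rho>))"
proof -
  define f where "f k = real (b choose k) * real t ^ (b - k)" for k
  have rel: "real (b choose Suc k) * real (Suc k) = real (b choose k) * real (b - k)" for k
    using binomial_absorb_comp[of b k] Suc_times_binomial_eq
    by (metis binomial_absorption binomial_absorb_comp mult.commute of_nat_mult)
  have up: "f k \<le> f (Suc k)" if "k < \<rho>" for k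
  proof -
    have kb: "k < b" using that assms(1) by (simp add: b_def less_le_trans)
    have "t * Suc k \<le> b - k"
    proof -
      have "(t + 1) * (k + 1) \<le> b" unfolding b_def using that by (intro mult_le_mono) auto
      then show ?thesis by (simp add: algebra_simps)
    qed
    then have *: "real t * real (Suc k) \<le> real (b - k)" by (metis of_nat_le_iff of_nat_mult)
    have "f k * real (Suc k) = real (b choose k) * (real t * real (Suc k)) * real t ^ (b - Suc k)"
      using kb by (simp add: f_def Suc_diff_Suc flip: power_Suc)
    also have "\<dots> \<le> real (b choose k) * real (b - k) * real t ^ (b - Suc k)"
      using * by (intro mult_right_mono mult_left_mono) auto
    also have "\<dots> = f (Suc k) * real (Suc k)" by (simp add: f_def flip: rel)
    finally show ?thesis by simp
  qed
  have down: "f (Suc k) \<le> f k" if "\<rho> \<le> k" for k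
  proof (cases "k < b")
    case True
    have "b - k \<le> t * Suc k"
    proof -
      have "b \<le> (t + 1) * k" unfolding b_def using that by (intro mult_le_mono) auto
      then show ?thesis by (simp add: algebra_simps)
    qed
    then have *: "real (b - k) \<le> real t * real (Suc k)" by (metis of_nat_le_iff of_nat_mult)
    have "f (Suc k) * real (Suc k) = real (b choose k) * real (b - k) * real t ^ (b - Suc k)"
      by (simp add: f_def flip: rel)
    also have "\<dots> \<le> real (b choose k) * (real t * real (Suc k)) * real t ^ (b - Suc k)"
      using * by (intro mult_right_mono mult_left_mono) auto
    also have "\<dots> = f k * real (Suc k)"
      using True by (simp add: f_def Suc_diff_Suc flip: power_Suc)
    finally show ?thesis by simp
  qed (simp add: f_def binomial_eq_0)
  have max: "f k \<le> f \<rho>" for k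
  proof (cases "k \<le> \<rho>")
    case True
    then show ?thesis
      by (induction k rule: inc_induct) (use up in \<open>auto intro: order_trans\<close>)
  next
    case False
    then have "\<rho> \<le> k" by simp
    then show ?thesis
      by (induction k rule: dec_induct) (use down in \<open>auto intro: order_trans\<close>)
  qed
  have "real (t + 1) ^ b = (\<Sum>k\<le>b. f k)"
    using binomial_ring[of 1 "real t" b] by (simp add: f_def add.commute)
  also have "\<dots> \<le> (\<Sum>k\<le>b. f \<rho>)" by (intro sum_mono max)
  finally show ?thesis by (simp add: f_def add.commute)
qed

lemma exists_covering_code:
  fixes t :: nat and \<beta> :: real
  assumes "0 < t" "2 * real t / (real t + 1) < \<beta>"
  shows "\<exists>b \<rho> (code :: bool list list). 0 < b \<and> (\<forall>c\<in>set code. length c = b) \<and>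
    (\<forall>w. length w = b \<longrightarrow> (\<exists>c\<in>set code. card {i. i < b \<and> c ! i \<noteq> w ! i} \<le> \<rho>)) \<and>
    real (length code) * real t ^ \<rho> \<le> \<beta> ^ b"
proof -
  define \<beta>0 where "\<beta>0 = 2 * real t / (real t + 1)"
  have b0: "0 < \<beta>0" "\<beta>0 < \<beta>" using assms by (auto simp: \<beta>0_def)
  define x where "x = \<beta> / \<beta>0"
  have x: "1 < x" using b0 by (simp add: x_def)
  \<comment> \<open>Two factors \<open>b + 1\<close> are lost, one in the greedy code and one in
    \<open>binomial_central_term\<close>; \<open>x ^ b\<close> outgrows them for long blocks. A
    length divisible by \<open>t + 1\<close> makes \<open>b / (t + 1)\<close> an integral
    radius.\<close>
  obtain \<rho> where rho: "0 < \<rho>" "(real ((t + 1) * \<rho>) + 1)^2 \<le> x ^ ((t + 1) * \<rho>)"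
  proof -
    have "(\<lambda>n. real n * (1 / sqrt x) ^ n) \<longlonglongrightarrow> 0"
      using x by (intro powser_times_n_limit_0) auto
    then have "eventually (\<lambda>n. real n * (1 / sqrt x) ^ n < 1 / 2) sequentially"
      by (rule order_tendstoD) simp
    then obtain m where m: "\<And>n. n \<ge> m \<Longrightarrow> real n * (1 / sqrt x) ^ n < 1 / 2"
      by (auto simp: eventually_sequentially)
    define n where "n = (t + 1) * Suc m"
    have "m \<le> n" "1 \<le> n" by (auto simp: n_def)
    then have "2 * real n < sqrt x ^ n" using m[of n] x by (simp add: power_divide field_simps)
    then have "real n + 1 \<le> sqrt x ^ n" using \<open>1 \<le> n\<close> by linarith
    then have "(real n + 1)^2 \<le> (sqrt x ^ n)^2" by (intro power_mono) auto
    also have "\<dots> = x ^ n" using x by (simp add: power_mult[symmetric] mult.commute[of n] power_mult)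
    finally show ?thesis using that[of "Suc m"] by (simp add: n_def)
  qed
  define b where "b = (t + 1) * \<rho>"
  have b: "0 < b" "\<rho> \<le> b" "(real b + 1)^2 \<le> x ^ b" using rho by (auto simp: b_def)
  obtain cs where cs: "\<forall>c\<in>set cs. c \<subseteq> {..<b}"
    "\<forall>w\<subseteq>{..<b}. \<exists>c\<in>set cs. card (sym_diff c w) \<le> \<rho>"
    "real (length cs) \<le> (real b + 1) * 2 ^ b / real (b choose \<rho>)"
    using covering_code_size[OF b(1,2)] by blast
  define code where "code = map (\<lambda>c. map (\<lambda>i. i \<in> c) [0..<b]) cs"
  have "\<exists>c\<in>set code. card {i. i < b \<and> c ! i \<noteq> w ! i} \<le> \<rho>" if w: "length w = b" for w
  proof -
    obtain c where c: "c \<in> set cs" "card (sym_diff c {i. i < b \<and> w ! i}) \<le> \<rho>"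
      using cs(2) by (metis (no_types, lifting) lessThan_iff mem_Collect_eq subsetI)
    have "{i. i < b \<and> map (\<lambda>i. i \<in> c) [0..<b] ! i \<noteq> w ! i} = sym_diff c {i. i < b \<and> w ! i}"
      using cs(1) c(1) by (auto simp: subset_iff)
    then have "card {i. i < b \<and> map (\<lambda>i. i \<in> c) [0..<b] ! i \<noteq> w ! i} \<le> \<rho>"
      using c(2) by (simp only:)
    moreover have "map (\<lambda>i. i \<in> c) [0..<b] \<in> set code" using c(1) by (auto simp: code_def)
    ultimately show ?thesis by blast
  qed
  moreover have "real (length code) * real t ^ \<rho> \<le> \<beta> ^ b"
  proof -
    define V where "V = real (b choose \<rho>)"
    have V: "0 < V" using b(2) by (simp add: V_def)
    have "real (t + 1) ^ b \<le> (real b + 1) * (V * real t ^ (b - \<rho>))"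
      using binomial_central_term[OF assms(1), of \<rho>] by (simp add: V_def b_def)
    then have "1 / V \<le> (real b + 1) * real t ^ (b - \<rho>) / real (t + 1) ^ b"
      using V by (simp add: field_simps)
    then have "(real b + 1) * 2 ^ b * real t ^ \<rho> * (1 / V) \<le>
        (real b + 1) * 2 ^ b * real t ^ \<rho> * ((real b + 1) * real t ^ (b - \<rho>) / real (t + 1) ^ b)"
      by (intro mult_left_mono) auto
    also have "\<dots> = (real b + 1)^2 * (2 ^ b * (real t ^ \<rho> * real t ^ (b - \<rho>)) / (real t + 1) ^ b)"
      by (simp add: power2_eq_square add.commute)
    also have "real t ^ \<rho> * real t ^ (b - \<rho>) = real t ^ b" using b(2) by (simp flip: power_add)
    also have "2 ^ b * real t ^ b / (real t + 1) ^ b = \<beta>0 ^ b"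
      by (simp add: \<beta>0_def power_divide power_mult_distrib)
    also have "(real b + 1)^2 * \<beta>0 ^ b \<le> x ^ b * \<beta>0 ^ b" using b b0 by (intro mult_right_mono) auto
    also have "\<dots> = \<beta> ^ b" using b0 by (simp add: x_def flip: power_mult_distrib)
    finally have "(real b + 1) * 2 ^ b / V * real t ^ \<rho> \<le> \<beta> ^ b" by (simp add: field_simps)
    moreover have "real (length code) * real t ^ \<rho> \<le> (real b + 1) * 2 ^ b / V * real t ^ \<rho>"
      using cs(3) by (intro mult_right_mono) (auto simp: code_def V_def)
    ultimately show ?thesis by linarith
  qed
  moreover have "\<forall>c\<in>set code. length c = b" by (auto simp: code_def)
  ultimately show ?thesis using b(1) by blast
qed

section \<open>The running time\<close>

text \<open>The order of quantifiers matters: code, radius and polynomial depend on \<open>t\<close>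
  alone, so one program handles all inputs.\<close>

lemma exists_enumeration_program:
  assumes "0 < t"
  defines "\<gamma> \<equiv> 3 - 2 / (real t + 1)"
  shows "\<exists>code rho (q :: real poly). \<forall>main rs s.
    length rs \<le> s \<and> (\<forall>r\<in>set rs. rule_length r \<le> t \<and> rule_length r \<le> s) \<and>
    card (prog_atoms (set rs)) \<le> s \<longrightarrow>
    (\<exists>Ms k. call (answer_set_program.prog main code rho) ENUM [enc_prog rs, SNil, SNil, SNil] =
        Some (enc_atom_lists Ms, k) \<and>
      real k \<le> poly q (real s) * \<gamma> ^ card (prog_atoms (set rs)) \<and>
      enumerates Ms {M. answer_set (set rs) M})"
proof -
  define \<beta>0 where "\<beta>0 = 2 * real t / (real t + 1)"
  have \<gamma>: "\<gamma> = 1 + \<beta>0" by (simp add: \<gamma>_def \<beta>0_def field_simps)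
  have pos: "0 < \<beta>0" using assms(1) by (simp add: \<beta>0_def)
  define \<delta> where "\<delta> = 1 - 1 / \<gamma> ^ t"
  have "1 < \<gamma> ^ t" using assms(1) pos by (simp add: \<gamma> one_less_power)
  then have \<delta>: "0 < \<delta>" "\<delta> < 1" by (simp_all add: \<delta>_def)
  define \<beta> where "\<beta> = \<beta>0 / \<delta>"
  \<comment> \<open>This strict gap is what allows a code of constant block length.\<close>
  have "\<beta>0 < \<beta>" using \<delta> pos by (simp add: \<beta>_def field_simps)
  then obtain b rho and code :: "bool list list" where code: "0 < b" "\<forall>c\<in>set code. length c = b"
    "\<forall>w. length w = b \<longrightarrow> (\<exists>c\<in>set code. card {i. i < b \<and> c ! i \<noteq> w ! i} \<le> rho)"
    "real (length code) * real t ^ rho \<le> \<beta> ^ b"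
    using exists_covering_code[OF assms(1), of \<beta>] unfolding \<beta>0_def by blast
  obtain kq where kq: "\<forall>p env. ev p env (quote_list (quote_list quote_bool) code) =
     Some (enc_list (enc_list sbool) code, kq)" using ev_quote_code by blast
  define Z :: "real poly" where "Z = [:1, 1:]"
  \<comment> \<open>\<open>S\<close> and \<open>q\<close> copy \<open>search_cost\<close> and
    \<open>node_cost * z\<close> as polynomials, with \<open>Z\<close> in place of \<open>z\<close>;
    1200 is three times the 400 of \<open>step_cost\<close>.\<close>
  define S where "S = smult 1200 (Z^3) * (smult rho Z + 1) + [:real (kq + 2 * rho + 40 * b + 200):]"
  define q where "q = (smult 400 (Z^3) + Z * (S * Z * [:\<beta> ^ b:] + smult 100 Z) + [:100:]) * Z"
  have "\<exists>Ms k. call (answer_set_program.prog main code rho) ENUM [enc_prog rs, SNil, SNil, SNil] =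
        Some (enc_atom_lists Ms, k) \<and>
      real k \<le> poly q (real s) * \<gamma> ^ card (prog_atoms (set rs)) \<and>
      enumerates Ms {M. answer_set (set rs) M}"
    if rs: "length rs \<le> s \<and> (\<forall>r\<in>set rs. rule_length r \<le> t \<and> rule_length r \<le> s) \<and>
      card (prog_atoms (set rs)) \<le> s" for main rs s
  proof -
    interpret bounded_code main code rho rs t s b \<beta> kq
      using rs code kq assms(1) by unfold_locales auto
    have "branch_sum \<gamma> t \<le> 1"
      using branch_sum_closed_form[of \<gamma> t] pos \<delta> by (simp add: \<gamma> \<beta>_def \<delta>_def)
    then have "\<exists>Ms k. call prog ENUM [enc_prog rs, SNil, SNil, SNil] = Some (enc_atom_lists Ms, k) \<and>
        real k \<le> node_cost * z * \<gamma> ^ card (prog_atoms (set rs)) \<and>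
        enumerates Ms {M. answer_set (set rs) M}"
      using rs pos \<delta> by (intro call_enum_initial) (auto simp: \<beta>_def \<gamma>)
    moreover have "poly Z (real s) = z" by (simp add: Z_def z_def)
    then have "poly q (real s) = node_cost * z"
      by (simp add: q_def S_def node_cost_def search_cost_def step_cost_def)
    ultimately show ?thesis by simp
  qed
  then show ?thesis by blast
qed

text \<open>The input size counts atom occurrences, so an empty clause or rule adds nothing to it. A
  repetition-free list contains at most one such entry \<open>e\<close>, whence the summand
  1.\<close>

lemma length_le_sum_plus_1:
  fixes f :: "'a \<Rightarrow> nat"
  assumes "distinct xs" "\<And>x. x \<in> set xs \<Longrightarrow> f x = 0 \<Longrightarrow> x = e"
  shows "length xs \<le> sum f (set xs) + 1"
proof -
  have "length xs = card (set xs)" using assms(1) by (simp add: distinct_card)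
  also have "\<dots> \<le> card (set xs - {e}) + 1" by (auto simp: card_Diff_singleton_if)
  also have "card (set xs - {e}) = (\<Sum>x\<in>set xs - {e}. 1)" by simp
  also have "\<dots> \<le> sum f (set xs - {e})"
    using assms(2) by (intro sum_mono) (auto simp: Suc_le_eq)
  also have "\<dots> \<le> sum f (set xs)" by (intro sum_mono2) auto
  finally show ?thesis by simp
qed

lemma card_prog_atoms_le:
  assumes "finite P"
  shows "card (prog_atoms P) \<le> prog_size P"
proof -
  have "card (rule_atoms r) \<le> rule_length r" for r
    using card_length[of "head r @ pos_body r @ neg_body r"]
    by (simp add: rule_atoms_def rule_length_def Un_assoc)
  then have "(\<Sum>r\<in>P. card (rule_atoms r)) \<le> prog_size P"
    unfolding prog_size_def by (intro sum_mono)
  then show ?thesis unfolding prog_atoms_def by (rule order_trans[OF card_UN_le[OF assms]])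
qed

lemma card_cnf_atoms_le:
  assumes "finite T"
  shows "card (cnf_atoms T) \<le> cnf_size T"
proof -
  have "card (atom_of ` set c) \<le> length c" for c
    using card_length[of "map atom_of c"] by simp
  then have "(\<Sum>c\<in>T. card (atom_of ` set c)) \<le> cnf_size T"
    unfolding cnf_size_def by (intro sum_mono)
  then show ?thesis unfolding cnf_atoms_def by (rule order_trans[OF card_UN_le[OF assms]])
qed

theorem theorem8p3:
  fixes t :: nat
  assumes "t \<ge> 2"
  shows
    "(\<exists>(alg :: lisp) (C :: real) (q :: real poly).
        \<forall>(T :: clause set) (xs :: clause list).
          t_cnf t T \<and> set xs = T \<and> distinct xs \<longrightarrow>
          (\<exists>(Ms :: atom list list) (k :: nat).
             runs alg (enc_cnf xs) (enc_atom_lists Ms) k \<and>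
             enumerates Ms {M. minimal_model (cnf_model T) M} \<and>
             real k \<le> C * (poly q (real (cnf_size T)) *
                            (3 - 2 / (real t + 1)) ^ card (cnf_atoms T))))
     \<and>
     (\<exists>(alg :: lisp) (C :: real) (q :: real poly).
        \<forall>(P :: rule set) (xs :: rule list).
          t_program t P \<and> set xs = P \<and> distinct xs \<longrightarrow>
          (\<exists>(Ms :: atom list list) (k :: nat).
             runs alg (enc_prog xs) (enc_atom_lists Ms) k \<and>
             enumerates Ms {M. answer_set P M} \<and>
             real k \<le> C * (poly q (real (prog_size P)) *
                            (3 - 2 / (real t + 1)) ^ card (prog_atoms P))))"
proof -
  let ?\<gamma> = "3 - 2 / (real t + 1)"
  have \<gamma>: "1 \<le> ?\<gamma> ^ n" for n by (intro one_le_power) (simp add: field_simps)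
  have "0 < t" using assms by simp
  then obtain code rho and q :: "real poly" where q: "\<And>main rs s.
    length rs \<le> s \<and> (\<forall>r\<in>set rs. rule_length r \<le> t \<and> rule_length r \<le> s) \<and>
    card (prog_atoms (set rs)) \<le> s \<Longrightarrow>
    \<exists>Ms k. call (answer_set_program.prog main code rho) ENUM [enc_prog rs, SNil, SNil, SNil] =
        Some (enc_atom_lists Ms, k) \<and>
      real k \<le> poly q (real s) * ?\<gamma> ^ card (prog_atoms (set rs)) \<and>
      enumerates Ms {M. answer_set (set rs) M}"
    using exists_enumeration_program[of t] by blast
  \<comment> \<open>The composition accounts for \<open>s = m + 1\<close>; the linear polynomial
    pays for the translation of clauses and the main call.\<close>
  define q' where "q' = pcompose (q + [:40, 180:]) [:1, 1:]"
  have q': "poly q' (real m) = poly q (real (m + 1)) + (40 + 180 * real (m + 1))" for m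
    by (simp add: q'_def poly_pcompose algebra_simps)
  have bound: "real (k + k') \<le> 1 * (poly q' (real m) * ?\<gamma> ^ n)"
    if "real k \<le> poly q (real (m + 1)) * ?\<gamma> ^ n" "k' \<le> 40 + 180 * (m + 1)" for k k' m n
  proof -
    have "real k' \<le> real (40 + 180 * (m + 1))" using that(2) by (simp only: of_nat_le_iff)
    then have "real k' \<le> (40 + 180 * real (m + 1)) * 1" by simp
    also have "\<dots> \<le> (40 + 180 * real (m + 1)) * ?\<gamma> ^ n" using \<gamma> by (intro mult_left_mono) auto
    finally show ?thesis using that(1) unfolding q' distrib_right by simp
  qed

  define main where "main = Call ENUM [Arg 0, Null, Null, Null]"
  \<comment> \<open>Unfolding \<open>main\<close> only under \<open>ev\<close> keeps it folded
    inside \<open>P.prog\<close>, so that facts about calls still match.\<close>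
  have ev_main: "ev p env main = ev p env (Call ENUM [Arg 0, Null, Null, Null])" for p env
    by (simp only: main_def)
  interpret P: answer_set_program main code rho .
  have prog: "\<exists>Ms k. runs P.prog (enc_prog xs) (enc_atom_lists Ms) k \<and>
      enumerates Ms {M. answer_set P M} \<and>
      real k \<le> 1 * (poly q' (real (prog_size P)) * ?\<gamma> ^ card (prog_atoms P))"
    if P: "t_program t P \<and> set xs = P \<and> distinct xs" for P xs
  proof -
    have fin: "finite P" using P by (simp add: t_program_def)
    have "length xs \<le> prog_size P + 1"
    proof -
      have "r = Rule [] [] []" if "rule_length r = 0" for r
        using that by (cases r) (simp add: rule_length_def)
      then show ?thesis using P length_le_sum_plus_1[of xs rule_length "Rule [] [] []"]
        by (auto simp: prog_size_def)
    qed
    moreover have "rule_length r \<le> t \<and> rule_length r \<le> prog_size P + 1" if "r \<in> set xs" for r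
      using P that fin member_le_sum[of r P rule_length] by (auto simp: t_program_def prog_size_def)
    moreover have "card (prog_atoms (set xs)) \<le> prog_size P + 1"
      using card_prog_atoms_le[OF fin] P by simp
    ultimately have "\<exists>Ms k. call P.prog ENUM [enc_prog xs, SNil, SNil, SNil] =
        Some (enc_atom_lists Ms, k) \<and>
      real k \<le> poly q (real (prog_size P + 1)) * ?\<gamma> ^ card (prog_atoms (set xs)) \<and>
      enumerates Ms {M. answer_set (set xs) M}"
      by (intro q conjI ballI) simp_all
    then obtain Ms k where k: "call P.prog ENUM [enc_prog xs, SNil, SNil, SNil] =
        Some (enc_atom_lists Ms, k)"
      "real k \<le> poly q (real (prog_size P + 1)) * ?\<gamma> ^ card (prog_atoms P)"
      "enumerates Ms {M. answer_set P M}"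
      using P by (elim exE conjE) (simp add: that)
    have "call P.prog 0 [enc_prog xs] = Some (enc_atom_lists Ms, k + 5)"
      using k(1) by (simp add: P.call_prog(1) ev_main)
    then have "runs P.prog (enc_prog xs) (enc_atom_lists Ms) (k + 5 + 2)" by (rule runs_if_call)
    moreover have "real (k + 7) \<le> 1 * (poly q' (real (prog_size P)) * ?\<gamma> ^ card (prog_atoms P))"
      using k(2) by (intro bound) auto
    ultimately show ?thesis using k(3) by (intro exI[of _ Ms] exI[of _ "k + 7"]) (simp add: add_ac)
  qed

  define main' where "main' = Call ENUM [Call CLAUSES [Arg 0], Null, Null, Null]"
  have ev_main': "ev p env main' = ev p env (Call ENUM [Call CLAUSES [Arg 0], Null, Null, Null])" for p env
    by (simp only: main'_def)
  interpret T: answer_set_program main' code rho .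
  have cnf: "\<exists>Ms k. runs T.prog (enc_cnf xs) (enc_atom_lists Ms) k \<and>
      enumerates Ms {M. minimal_model (cnf_model T) M} \<and>
      real k \<le> 1 * (poly q' (real (cnf_size T)) * ?\<gamma> ^ card (cnf_atoms T))"
    if T: "t_cnf t T \<and> set xs = T \<and> distinct xs" for T xs
  proof -
    have fin: "finite T" using T by (simp add: t_cnf_def)
    have len: "length xs \<le> cnf_size T + 1"
      using T length_le_sum_plus_1[of xs length "[]"] by (auto simp: cnf_size_def)
    moreover have "rule_length r \<le> t \<and> rule_length r \<le> cnf_size T + 1" if "r \<in> set (cnf_rules xs)" for r
    proof -
      obtain c where c: "c \<in> T" "rule_length r = length c"
        using \<open>r \<in> set (cnf_rules xs)\<close> T by (auto simp: clause_rule_sets)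
      then show ?thesis using T fin member_le_sum[of c T length] by (auto simp: t_cnf_def cnf_size_def)
    qed
    moreover have "card (prog_atoms (set (cnf_rules xs))) \<le> cnf_size T + 1"
      unfolding prog_atoms_cnf_rules using card_cnf_atoms_le[OF fin] T by simp
    ultimately have "\<exists>Ms k. call T.prog ENUM [enc_prog (cnf_rules xs), SNil, SNil, SNil] =
        Some (enc_atom_lists Ms, k) \<and>
      real k \<le> poly q (real (cnf_size T + 1)) * ?\<gamma> ^ card (prog_atoms (set (cnf_rules xs))) \<and>
      enumerates Ms {M. answer_set (set (cnf_rules xs)) M}"
      by (intro q conjI ballI) simp_all
    then obtain Ms k where k: "call T.prog ENUM [enc_prog (cnf_rules xs), SNil, SNil, SNil] =
        Some (enc_atom_lists Ms, k)"
      "real k \<le> poly q (real (cnf_size T + 1)) * ?\<gamma> ^ card (cnf_atoms T)"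
      "enumerates Ms {M. minimal_model (cnf_model T) M}"
      unfolding prog_atoms_cnf_rules answer_set_cnf_rules using T
      by (elim exE conjE) (simp add: that)
    obtain k' where k': "call T.prog CLAUSES [enc_cnf xs] = Some (enc_prog (cnf_rules xs), k')"
      "k' \<le> 60 * (sum_list (map length xs) + 2 * length xs) + 5" using T.call_clauses by blast
    have "sum_list (map length xs) = cnf_size T"
      using T by (auto simp: cnf_size_def sum_list_distinct_conv_sum_set)
    then have "k' + 8 \<le> 40 + 180 * (cnf_size T + 1)" using k'(2) len by simp
    then have "real (k + (k' + 8)) \<le> 1 * (poly q' (real (cnf_size T)) * ?\<gamma> ^ card (cnf_atoms T))"
      using k(2) by (intro bound)
    moreover have "call T.prog 0 [enc_cnf xs] = Some (enc_atom_lists Ms, k + k' + 6)"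
      using k(1) k'(1) by (simp add: T.call_prog(1) ev_main')
    then have "runs T.prog (enc_cnf xs) (enc_atom_lists Ms) (k + k' + 6 + 2)" by (rule runs_if_call)
    ultimately show ?thesis using k(3) by (intro exI[of _ Ms] exI[of _ "k + (k' + 8)"]) (simp add: add_ac)
  qed

  show ?thesis
  proof (rule conjI)
    show "\<exists>(alg :: lisp) (C :: real) (q :: real poly).
        \<forall>(T :: clause set) (xs :: clause list).
          t_cnf t T \<and> set xs = T \<and> distinct xs \<longrightarrow>
          (\<exists>(Ms :: atom list list) (k :: nat).
             runs alg (enc_cnf xs) (enc_atom_lists Ms) k \<and>
             enumerates Ms {M. minimal_model (cnf_model T) M} \<and>
             real k \<le> C * (poly q (real (cnf_size T)) * ?\<gamma> ^ card (cnf_atoms T)))"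
      by (rule exI[of _ T.prog], rule exI[of _ 1], rule exI[of _ q'], intro allI impI, rule cnf)
    show "\<exists>(alg :: lisp) (C :: real) (q :: real poly).
        \<forall>(P :: rule set) (xs :: rule list).
          t_program t P \<and> set xs = P \<and> distinct xs \<longrightarrow>
          (\<exists>(Ms :: atom list list) (k :: nat).
             runs alg (enc_prog xs) (enc_atom_lists Ms) k \<and>
             enumerates Ms {M. answer_set P M} \<and>
             real k \<le> C * (poly q (real (prog_size P)) * ?\<gamma> ^ card (prog_atoms P)))"
      by (rule exI[of _ P.prog], rule exI[of _ 1], rule exI[of _ q'], intro allI impI, rule prog)
  qed
qed

end
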